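(* For every graph $G$, $G$ is cyclically orientable if and only if $G$ is $\{K_4,K_{2,3}\}$-induced-minor-free.
   Context: All graphs are finite and simple. A graph is cyclically orientable if it admits an orientation in which every chordless (induced) cycle is oriented cyclically, i.e. as a directed cycle (an orientation of a cycle with no sink). $H$ is an induced minor of $G$ if $H$ can be obtained from $G$ by vertex deletions and edge contractions; $G$ is $\mathcal F$-induced-minor-free if no member of $\mathcal F$ is an induced minor of $G$. *)

theory Defs
  imports Main
begin

type_synonym 'a graph = "'a set \<times> 'a set set"

definition simple_graph :: "'a graph \<Rightarrow> bool" where
  "simple_graph G \<longleftrightarrow> finite (fst G) \<and> (\<forall>e\<in>snd G. e \<subseteq> fst G \<and> card e = 2)"

definition delete_vertex :: "'a \<Rightarrow> 'a graph \<Rightarrow> 'a graph" where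
  "delete_vertex v G = (fst G - {v}, {e \<in> snd G. v \<notin> e})"

definition contract_edge :: "'a \<Rightarrow> 'a \<Rightarrow> 'a graph \<Rightarrow> 'a graph" where
  "contract_edge u v G =
     (fst G - {v}, {e \<in> snd G. v \<notin> e} \<union> {{u, w} | w. {v, w} \<in> snd G \<and> w \<noteq> u})"

inductive minor_step :: "'a graph \<Rightarrow> 'a graph \<Rightarrow> bool" where
  del: "v \<in> fst G \<Longrightarrow> minor_step G (delete_vertex v G)"
| con: "{u, v} \<in> snd G \<Longrightarrow> u \<noteq> v \<Longrightarrow> minor_step G (contract_edge u v G)"

definition graph_iso :: "'a graph \<Rightarrow> 'b graph \<Rightarrow> ('a \<Rightarrow> 'b) \<Rightarrow> bool" where
  "graph_iso G H f \<longleftrightarrow> bij_betw f (fst G) (fst H) \<and>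
     (\<forall>x\<in>fst G. \<forall>y\<in>fst G. {x, y} \<in> snd G \<longleftrightarrow> {f x, f y} \<in> snd H)"

definition induced_minor :: "'b graph \<Rightarrow> 'a graph \<Rightarrow> bool" where
  "induced_minor H G \<longleftrightarrow> (\<exists>G'. minor_step\<^sup>*\<^sup>* G G' \<and> (\<exists>f. graph_iso G' H f))"

definition K4 :: "nat graph" where
  "K4 = ({0..3}, {e. \<exists>x y. e = {x, y} \<and> x \<noteq> y \<and> x \<in> {0..3} \<and> y \<in> {0..3}})"

definition K23 :: "nat graph" where
  "K23 = ({0..4}, {e. \<exists>x y. e = {x, y} \<and> x \<in> {0, 1} \<and> y \<in> {2, 3, 4}})"

definition is_orientation :: "'a graph \<Rightarrow> ('a \<times> 'a) set \<Rightarrow> bool" where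
  "is_orientation G D \<longleftrightarrow> D \<subseteq> {(x, y). {x, y} \<in> snd G} \<and>
     (\<forall>x y. {x, y} \<in> snd G \<longrightarrow> ((x, y) \<in> D \<longleftrightarrow> (y, x) \<notin> D))"

definition chordless_cycle :: "'a graph \<Rightarrow> 'a list \<Rightarrow> bool" where
  "chordless_cycle G cs \<longleftrightarrow> length cs \<ge> 3 \<and> distinct cs \<and> set cs \<subseteq> fst G \<and>
     (\<forall>i<length cs. \<forall>j<length cs.
        {cs ! i, cs ! j} \<in> snd G \<longleftrightarrow>
          (j = Suc i mod length cs \<or> i = Suc j mod length cs))"

definition cyclically_oriented :: "('a \<times> 'a) set \<Rightarrow> 'a list \<Rightarrow> bool" where
  "cyclically_oriented D cs \<longleftrightarrow>
     (\<forall>i<length cs. (cs ! i, cs ! (Suc i mod length cs)) \<in> D) \<or>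
     (\<forall>i<length cs. (cs ! (Suc i mod length cs), cs ! i) \<in> D)"

definition cyclically_orientable :: "'a graph \<Rightarrow> bool" where
  "cyclically_orientable G \<longleftrightarrow>
     (\<exists>D. is_orientation G D \<and> (\<forall>cs. chordless_cycle G cs \<longrightarrow> cyclically_oriented D cs))"

end

theory Submission
  imports Defs
begin

text \<open>Call a chordless cycle \<open>C\<close> together with a disjoint connected set \<open>Q\<close> bad if \<open>Q\<close> is adjacent to two
  nonadjacent vertices of \<open>C\<close>, or to all of \<open>C\<close>. A graph has a bad pair iff it has
  \<open>K\<^sub>4\<close> or \<open>K\<^sub>2\<^sub>,\<^sub>3\<close> as an induced minor: contracting \<open>Q\<close> and suitable arcs of \<open>C\<close> yields one of the
  two, and conversely both contain a bad pair and bad pairs lift along deletions and contractions.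

  A cyclic orientation excludes bad pairs. From a bad pair one obtains a vertex \<open>y\<close> of \<open>C\<close>, with cycle
  neighbours \<open>s\<close> and \<open>t\<close>, and a single neighbour \<open>r\<close> of \<open>y\<close> in \<open>Q\<close> such that each two of
  \<open>r\<close>, \<open>s\<close>, \<open>t\<close> lie with \<open>y\<close> on a chordless cycle; but a cyclic orientation would have to
  direct every two of the three edges at \<open>y\<close> oppositely.

  Conversely, in a graph without bad pairs either a chordless cycle spans the graph, or a component of
  its complement attaches to it in a clique of size at most two. Orientations of the two sides of such a
  clique separation can be glued after possibly reversing one of them, since no chordless cycle
  crosses a clique.\<close>

section \<open>Connected sets, induced paths and chordless cycles\<close>

definition adj :: "'a graph \<Rightarrow> 'a \<Rightarrow> 'a \<Rightarrow> bool" where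
  "adj G x y \<longleftrightarrow> {x, y} \<in> snd G"

lemma adj_sym: "adj G x y \<Longrightarrow> adj G y x"
  by (simp add: adj_def insert_commute)

lemma adj_commute: "adj G x y \<longleftrightarrow> adj G y x"
  by (simp add: adj_def insert_commute)

lemma symp_adj: "symp (adj G)"
  by (auto intro: sympI adj_sym)

lemma adj_irrefl: "simple_graph G \<Longrightarrow> \<not> adj G x x"
  by (force simp: adj_def simple_graph_def)

lemma irreflp_adj: "simple_graph G \<Longrightarrow> irreflp (adj G)"
  by (auto intro: irreflpI dest: adj_irrefl)

lemma adj_in_verts: "simple_graph G \<Longrightarrow> adj G x y \<Longrightarrow> x \<in> fst G \<and> y \<in> fst G"
  by (auto simp: adj_def simple_graph_def)

section \<open>Connected vertex sets\<close>

text \<open>Connectivity is phrased by closed subsets instead of walks, which suits unions, images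
  and restrictions. The empty set counts as connected. The parameter is a bare relation so that
  adjacency in different graphs can be compared.\<close>

definition conn :: "('a \<Rightarrow> 'a \<Rightarrow> bool) \<Rightarrow> 'a set \<Rightarrow> bool" where
  "conn E S \<longleftrightarrow> (\<forall>A\<subseteq>S. A \<noteq> {} \<longrightarrow> (\<forall>a\<in>A. \<forall>b\<in>S. E a b \<longrightarrow> b \<in> A) \<longrightarrow> A = S)"

lemma connD:
  assumes "conn E S" "A \<subseteq> S" "A \<noteq> {}" "A \<noteq> S"
  obtains a b where "a \<in> A" "b \<in> S" "b \<notin> A" "E a b"
  using assms unfolding conn_def by metis

lemma conn_singleton [simp]: "conn E {x}"
  by (auto simp: conn_def)

text \<open>A closed set meets each of \<open>S\<close> and \<open>T\<close> in nothing or in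
  everything, and the edge from \<open>s\<close> to \<open>t\<close> forces the same choice on both
  sides.\<close>

lemma conn_Un:
  assumes "symp E" "conn E S" "conn E T" "s \<in> S" "t \<in> T" "E s t"
  shows "conn E (S \<union> T)"
  unfolding conn_def
proof (intro allI impI)
  fix A assume A: "A \<subseteq> S \<union> T" "A \<noteq> {}" "\<forall>a\<in>A. \<forall>b\<in>S \<union> T. E a b \<longrightarrow> b \<in> A"
  have S: "A \<inter> S = {} \<or> A \<inter> S = S"
    using assms(2) A(3) unfolding conn_def by (metis Int_iff Int_lower2 Un_iff)
  have T: "A \<inter> T = {} \<or> A \<inter> T = T"
    using assms(3) A(3) unfolding conn_def by (metis Int_iff Int_lower2 Un_iff)
  have "s \<in> A \<longleftrightarrow> t \<in> A" using A(3) assms sympD[OF assms(1)] by blast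
  with S T A assms(4,5) show "A = S \<union> T" by blast
qed

lemma conn_insert:
  assumes "symp E" "conn E S" "s \<in> S" "E x s"
  shows "conn E (insert x S)"
  using conn_Un[OF assms(1) conn_singleton[of E x] assms(2) _ assms(3,4)] by simp

text \<open>The preimage of a closed set is closed. The alternative \<open>f a = f b\<close> permits
  collapsed edges, as needed for contractions.\<close>

lemma conn_image:
  assumes "conn E S" and hom: "\<And>a b. a \<in> S \<Longrightarrow> b \<in> S \<Longrightarrow> E a b \<Longrightarrow> f a = f b \<or> E' (f a) (f b)"
  shows "conn E' (f ` S)"
  unfolding conn_def
proof (intro allI impI)
  fix A assume A: "A \<subseteq> f ` S" "A \<noteq> {}" "\<forall>a\<in>A. \<forall>b\<in>f ` S. E' a b \<longrightarrow> b \<in> A"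
  have "{x \<in> S. f x \<in> A} = S"
  proof (rule ccontr)
    assume neq: "{x \<in> S. f x \<in> A} \<noteq> S"
    have ne: "{x \<in> S. f x \<in> A} \<noteq> {}" using A(1,2) by auto
    have "{x \<in> S. f x \<in> A} \<subseteq> S" by auto
    from connD[OF assms(1) this ne neq]
    obtain a b where "a \<in> {x \<in> S. f x \<in> A}" "b \<in> S" "b \<notin> {x \<in> S. f x \<in> A}" "E a b" .
    then show False using hom[of a b] A(3) by auto
  qed
  then have "f ` S \<subseteq> A" by (metis (mono_tags, lifting) image_subsetI mem_Collect_eq)
  then show "A = f ` S" using A(1) by (rule equalityI[rotated])
qed

lemma conn_cong:
  assumes "\<And>a b. a \<in> S \<Longrightarrow> b \<in> S \<Longrightarrow> E a b \<longleftrightarrow> E' a b"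
  shows "conn E S \<longleftrightarrow> conn E' S"
proof -
  have "conn E' S" if "conn E S" using conn_image[OF that, of id E'] assms by auto
  moreover have "conn E S" if "conn E' S" using conn_image[OF that, of id E] assms by auto
  ultimately show ?thesis by blast
qed

text \<open>Existence of a non-cut vertex: a maximal proper nonempty connected subset can be
  enlarged by one adjacent vertex, so by maximality it misses only that vertex.\<close>

lemma conn_delete_vertex:
  assumes sym: "symp E" and "finite Q" "conn E Q" "q \<in> Q" "Q \<noteq> {q}"
  obtains r where "r \<in> Q" "conn E (Q - {r})" "Q - {r} \<noteq> {}"
proof -
  define F where "F = {S. S \<subset> Q \<and> S \<noteq> {} \<and> conn E S}"
  have "finite F" using assms(2) by (auto simp: F_def intro: finite_subset[of _ "Pow Q"])
  moreover have "{q} \<in> F" using assms by (auto simp: F_def)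
  ultimately obtain S where S: "S \<in> F" "\<And>T. T \<in> F \<Longrightarrow> S \<subseteq> T \<Longrightarrow> S = T"
    using finite_has_maximal[of F] by blast
  obtain a b where ab: "a \<in> S" "b \<in> Q" "b \<notin> S" "E a b"
    using connD[OF assms(3), of S] S(1) by (auto simp: F_def)
  have "conn E (insert b S)" using conn_insert[OF sym, of S a b] ab sympD[OF sym] S(1) by (auto simp: F_def)
  then have "insert b S = Q" using S(2)[of "insert b S"] ab S(1) by (auto simp: F_def)
  then have "Q - {b} = S" using ab by blast
  then show ?thesis using that[of b] ab S(1) by (auto simp: F_def)
qed

text \<open>A maximal connected subset of \<open>W\<close> containing \<open>q\<close> is a
  component, since any neighbour in \<open>W\<close> could be added to it.\<close>

lemma component_exists:
  assumes sym: "symp E" and "finite W" "q \<in> W"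
  obtains Q where "conn E Q" "q \<in> Q" "Q \<subseteq> W" "\<And>a b. a \<in> Q \<Longrightarrow> b \<in> W \<Longrightarrow> E a b \<Longrightarrow> b \<in> Q"
proof -
  define F where "F = {S. S \<subseteq> W \<and> q \<in> S \<and> conn E S}"
  have "finite F" using assms(2) by (auto simp: F_def intro: finite_subset[of _ "Pow W"])
  moreover have "{q} \<in> F" using assms by (auto simp: F_def)
  ultimately obtain S where S: "S \<in> F" "\<And>T. T \<in> F \<Longrightarrow> S \<subseteq> T \<Longrightarrow> S = T"
    using finite_has_maximal[of F] by blast
  have "b \<in> S" if "a \<in> S" "b \<in> W" "E a b" for a b
  proof -
    have "conn E (insert b S)" using conn_insert[OF sym, of S a b] that sympD[OF sym] S(1) by (auto simp: F_def)
    then have "S = insert b S" using S(1) S(2)[of "insert b S"] that by (auto simp: F_def)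
    then show ?thesis by blast
  qed
  then show ?thesis using that[of S] S(1) by (auto simp: F_def)
qed

section \<open>Induced paths\<close>

text \<open>Lists the vertices of an induced path: among the later vertices each one sees exactly
  the next. For a single vertex the quantifier is empty, so the value of \<open>hd []\<close> is
  irrelevant.\<close>

fun ipath :: "('a \<Rightarrow> 'a \<Rightarrow> bool) \<Rightarrow> 'a list \<Rightarrow> bool" where
  "ipath E [] \<longleftrightarrow> True"
| "ipath E (x # p) \<longleftrightarrow> x \<notin> set p \<and> (\<forall>z\<in>set p. E x z \<longleftrightarrow> z = hd p) \<and> ipath E p"

lemma ipath_append:
  "ipath E (p @ q) \<longleftrightarrow> ipath E p \<and> ipath E q \<and> set p \<inter> set q = {} \<and>
     (\<forall>x\<in>set p. \<forall>z\<in>set q. E x z \<longleftrightarrow> x = last p \<and> z = hd q)"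
proof (induction p)
  case (Cons x p)
  show ?case
  proof (cases "p = []")
    case True
    then show ?thesis by auto
  next
    case False
    then have l: "hd (p @ q) = hd p" "last (x # p) = last p" "last p \<in> set p" "hd p \<in> set p" by auto
    \<comment> \<open>Both sides say that \<open>x\<close> has no neighbour in \<open>q\<close>:
      \<open>hd p\<close> lies outside \<open>q\<close>, and \<open>x\<close> differs from
      \<open>last p\<close>.\<close>
    have k: "(\<forall>z\<in>set q. E x z \<longleftrightarrow> z = hd p) \<longleftrightarrow> (\<forall>z\<in>set q. E x z \<longleftrightarrow> x = last p \<and> z = hd q)"
      if "set p \<inter> set q = {}" "x \<notin> set p"
    proof -
      have "(z = hd p) = (x = last p \<and> z = hd q)" if "z \<in> set q" for z
        using that \<open>set p \<inter> set q = {}\<close> \<open>x \<notin> set p\<close> l(3,4) by (metis disjoint_iff)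
      then show ?thesis by (simp cong: ball_cong)
    qed
    have i: "set (x # p) \<inter> set q = {} \<longleftrightarrow> x \<notin> set q \<and> set p \<inter> set q = {}" by auto
    show ?thesis
      unfolding append_Cons ipath.simps l(1,2) Cons.IH i
      unfolding set_append list.set ball_simps ball_Un Un_iff
      using k by argo
  qed
qed simp

lemma ipath_cong:
  assumes "\<And>a b. a \<in> set p \<Longrightarrow> b \<in> set p \<Longrightarrow> E a b \<longleftrightarrow> E' a b"
  shows "ipath E p \<longleftrightarrow> ipath E' p"
  using assms by (induction p) auto

lemma ipath_conn:
  assumes sym: "symp E" and "ipath E p"
  shows "conn E (set p)"
  using assms(2)
proof (induction p)
  case (Cons x p)
  show ?case
  proof (cases "p = []")
    case False
    then show ?thesis using Cons conn_insert[OF sym, of "set p" "hd p" x] by auto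
  qed simp
qed (simp add: conn_def)

text \<open>The vertices reachable from \<open>s\<close> by an induced path inside \<open>T\<close>
  form a nonempty closed subset of \<open>T\<close>, hence all of \<open>T\<close>.\<close>

lemma conn_ipath:
  assumes sym: "symp E" and "conn E T" "s \<in> T" "t \<in> T"
  obtains p where "ipath E p" "p \<noteq> []" "hd p = s" "last p = t" "set p \<subseteq> T"
proof -
  define A where "A = {x. \<exists>p. ipath E p \<and> p \<noteq> [] \<and> hd p = s \<and> last p = x \<and> set p \<subseteq> T}"
  have "s \<in> A" unfolding A_def using assms by (auto intro!: exI[of _ "[s]"])
  have "A \<subseteq> T" unfolding A_def by auto
  have "b \<in> A" if "a \<in> A" "b \<in> T" "E a b" for a b
  proof -
    obtain p where p: "ipath E p" "p \<noteq> []" "hd p = s" "last p = a" "set p \<subseteq> T"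
      using \<open>a \<in> A\<close> unfolding A_def by auto
    show ?thesis
    proof (cases "b \<in> set p")
      case True
      then obtain p1 p2 where q: "p = (p1 @ [b]) @ p2" by (auto simp: in_set_conv_decomp)
      have "ipath E (p1 @ [b])" using p(1) unfolding q ipath_append[of E "p1 @ [b]"] by blast
      moreover have "hd (p1 @ [b]) = s" using p(3) q by (cases p1) auto
      ultimately show ?thesis using p(5) q unfolding A_def by (auto intro!: exI[of _ "p1 @ [b]"])
    next
      case False
      \<comment> \<open>Cutting the path at the first vertex that sees \<open>b\<close> keeps it
        induced after \<open>b\<close> is appended.\<close>
      have "\<exists>x\<in>set p. E x b" using p that by auto
      then obtain p1 z p2 where q: "p = p1 @ z # p2" "E z b" "\<forall>y\<in>set p1. \<not> E y b"
        using split_list_first_prop[of p "\<lambda>x. E x b"] by blast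
      have "p = (p1 @ [z]) @ p2" using q by simp
      with p(1) have "ipath E (p1 @ [z])" using ipath_append[of E "p1 @ [z]" p2] by simp
      moreover have "z \<notin> set p1" using p(1) q(1) by (simp add: ipath_append)
      ultimately have "ipath E ((p1 @ [z]) @ [b])" using False q
        unfolding ipath_append[of E "p1 @ [z]"] by auto
      moreover have "hd ((p1 @ [z]) @ [b]) = s" using p(3) q by (cases p1) auto
      ultimately show ?thesis using p(5) q \<open>b \<in> T\<close> unfolding A_def
        by (auto intro!: exI[of _ "(p1 @ [z]) @ [b]"])
    qed
  qed
  then have "A = T" using assms(2) \<open>s \<in> A\<close> \<open>A \<subseteq> T\<close> unfolding conn_def by blast
  then show ?thesis using that assms(4) unfolding A_def by blast
qed

lemma all_less_Suc_pair:
  "(\<forall>i<Suc n. \<forall>j<Suc n. F i j) \<longleftrightarrow> F 0 0 \<and> (\<forall>j<n. F 0 (Suc j)) \<and> (\<forall>i<n. F (Suc i) 0) \<and>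
     (\<forall>i<n. \<forall>j<n. F (Suc i) (Suc j))"
  by (simp add: All_less_Suc2) blast

lemma ipath_nth:
  assumes sym: "symp E" and irrefl: "irreflp E"
  shows "ipath E p \<longleftrightarrow> distinct p \<and>
    (\<forall>i<length p. \<forall>j<length p. E (p ! i) (p ! j) \<longleftrightarrow> (j = Suc i \<or> i = Suc j))"
proof (induction p)
  case (Cons x p)
  have s: "E (p ! i) x \<longleftrightarrow> E x (p ! i)" for i using sym by (metis sympD)
  have "\<not> E x x" using irreflpD[OF irrefl] .
  then have "(\<forall>i<length (x # p). \<forall>j<length (x # p). E ((x # p) ! i) ((x # p) ! j) \<longleftrightarrow> (j = Suc i \<or> i = Suc j))
    \<longleftrightarrow> (\<forall>i<length p. E x (p ! i) \<longleftrightarrow> i = 0) \<and>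
      (\<forall>i<length p. \<forall>j<length p. E (p ! i) (p ! j) \<longleftrightarrow> (j = Suc i \<or> i = Suc j))"
    unfolding list.size add_Suc_right add_0_right all_less_Suc_pair by (simp add: s)
  moreover have "(\<forall>z\<in>set p. E x z \<longleftrightarrow> z = hd p) \<longleftrightarrow> (\<forall>i<length p. E x (p ! i) \<longleftrightarrow> i = 0)"
    if "distinct p"
  proof -
    have "p ! i = hd p \<longleftrightarrow> i = 0" if "i < length p" for i
      using that \<open>distinct p\<close> by (cases p) (auto simp: nth_eq_iff_index_eq nth_Cons')
    then show ?thesis unfolding all_set_conv_all_nth by (simp cong: imp_cong)
  qed
  ultimately show ?case
    unfolding ipath.simps Cons.IH distinct.simps by argo
qed simp

section \<open>Chordless cycles with a base vertex\<close>

text \<open>A chordless cycle is cut open at the base \<open>y\<close>: the rest is an induced path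
  of which \<open>y\<close> sees exactly the two ends. Length at least 2 makes the ends
  distinct.\<close>

definition icycle :: "('a \<Rightarrow> 'a \<Rightarrow> bool) \<Rightarrow> 'a \<Rightarrow> 'a list \<Rightarrow> bool" where
  "icycle E y p \<longleftrightarrow> length p \<ge> 2 \<and> y \<notin> set p \<and> ipath E p \<and>
     (\<forall>z\<in>set p. E y z \<longleftrightarrow> z = hd p \<or> z = last p)"

text \<open>The cyclic order \<open>y\<close>, \<open>p1\<close>, \<open>z\<close>,
  \<open>p2\<close> is read again starting from \<open>z\<close>. The cases on empty
  \<open>p1\<close> or \<open>p2\<close> arise because \<open>y\<close> is then itself an end of the
  new path.\<close>

lemma icycle_rotate_append:
  assumes sym: "symp E" and c: "icycle E y (p1 @ z # p2)"
  shows "icycle E z (p2 @ y # p1)"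
proof -
  have s: "E a b \<longleftrightarrow> E b a" for a b using sym by (metis sympD)
  have D: "y \<notin> set p1" "y \<notin> set p2" "y \<noteq> z" "z \<notin> set p1" "z \<notin> set p2" "set p1 \<inter> set p2 = {}"
    and P: "ipath E p1" "ipath E p2"
    using c by (auto simp: icycle_def ipath_append)
  have c1: "\<forall>x\<in>set p1. E x z \<longleftrightarrow> x = last p1" and c2: "\<forall>x\<in>set p1. \<forall>w\<in>set p2. \<not> E x w"
    and c3: "\<forall>w\<in>set p2. E z w \<longleftrightarrow> w = hd p2"
  proof -
    have "\<forall>x\<in>set p1. \<forall>w\<in>set (z # p2). E x w \<longleftrightarrow> x = last p1 \<and> w = z"
      using c unfolding icycle_def ipath_append by simp
    then show "\<forall>x\<in>set p1. E x z \<longleftrightarrow> x = last p1" "\<forall>x\<in>set p1. \<forall>w\<in>set p2. \<not> E x w"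
      using D by auto
    show "\<forall>w\<in>set p2. E z w \<longleftrightarrow> w = hd p2"
      using c unfolding icycle_def ipath_append by simp
  qed
  have cy: "E y w \<longleftrightarrow> w = hd (p1 @ z # p2) \<or> w = last (p1 @ z # p2)" if "w \<in> set (p1 @ z # p2)" for w
    using c that unfolding icycle_def by blast
  have cy1: "E y w \<longleftrightarrow> w = hd p1" if "w \<in> set p1" for w
    using cy[of w] that D by (cases p1; cases p2 rule: rev_cases) auto
  have cy2: "E y w \<longleftrightarrow> w = last p2" if "w \<in> set p2" for w
    using cy[of w] that D by (cases p1; cases p2 rule: rev_cases) auto
  \<comment> \<open>\<open>z\<close> is an end of the old path exactly when one of the two pieces is
    empty.\<close>
  have cyz: "E y z \<longleftrightarrow> p1 = [] \<or> p2 = []"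
    using cy[of z] D by (cases p1; cases p2 rule: rev_cases) auto
  have "ipath E (y # p1)" using D P cy1 by simp
  moreover have "E a b \<longleftrightarrow> a = last p2 \<and> b = y" if "a \<in> set p2" "b \<in> set (y # p1)" for a b
    using that D c2 cy2[of a] s[of a b] by auto
  ultimately have "ipath E (p2 @ y # p1)"
    unfolding ipath_append using D P by auto
  moreover have "E z w \<longleftrightarrow> w = hd (p2 @ y # p1) \<or> w = last (p2 @ y # p1)"
    if "w \<in> set (p2 @ y # p1)" for w
  proof -
    consider "w \<in> set p2" | "w = y" | "w \<in> set p1" using \<open>w \<in> set (p2 @ y # p1)\<close> by auto
    then show ?thesis
    proof cases
      case 1
      then show ?thesis using c3 D by (cases p2; cases p1 rule: rev_cases) auto
    next
      case 2
      then show ?thesis using cyz s[of z y] D by (cases p2; cases p1 rule: rev_cases) auto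
    next
      case 3
      then show ?thesis using c1 s[of z w] D by (cases p2; cases p1 rule: rev_cases) auto
    qed
  qed
  moreover have "length (p2 @ y # p1) \<ge> 2" "z \<notin> set (p2 @ y # p1)"
    using c D by (simp_all add: icycle_def)
  ultimately show ?thesis unfolding icycle_def by blast
qed

text \<open>Any vertex of the cycle may be taken as base; later arguments use this to put the
  critical vertex there.\<close>

lemma icycle_rotate:
  assumes sym: "symp E" and "icycle E y p" "z \<in> insert y (set p)"
  obtains p' where "icycle E z p'" "insert z (set p') = insert y (set p)"
proof (cases "z = y")
  case False
  then have "z \<in> set p" using assms(3) by blast
  then obtain p1 p2 where q: "p = p1 @ z # p2" by (meson split_list)
  show ?thesis
  proof (rule that)
    show "icycle E z (p2 @ y # p1)" using icycle_rotate_append[OF sym] assms(2) q by metis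
    show "insert z (set (p2 @ y # p1)) = insert y (set p)" unfolding q by auto
  qed
next
  case True
  show ?thesis
    by (rule that[of p]) (simp_all only: True assms(2))
qed

lemma Suc_mod_less: "i < n \<Longrightarrow> Suc i mod n = (if Suc i = n then 0 else Suc i)" for n :: nat
  by auto

text \<open>Position 0 of \<open>y # p\<close> is the base and position \<open>Suc i\<close> is
  entry \<open>i\<close> of \<open>p\<close>. The modular condition splits into the row of the base,
  which sees the first and last entry, and the block of \<open>p\<close>, where wraparound never
  matters because it leads only to position 0.\<close>

lemma icycle_nth:
  assumes "symp E" "irreflp E" and n: "n = length p" "n \<ge> 2"
  shows "icycle E y p \<longleftrightarrow> distinct (y # p) \<and>
     (\<forall>i<Suc n. \<forall>j<Suc n. E ((y # p) ! i) ((y # p) ! j) \<longleftrightarrow> j = Suc i mod Suc n \<or> i = Suc j mod Suc n)"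
proof -
  have "p \<noteq> []" using n by auto
  then have h: "hd p = p ! 0" "last p = p ! (n - 1)" by (simp_all add: hd_conv_nth last_conv_nth n)
  have hl: "(\<forall>z\<in>set p. E y z \<longleftrightarrow> z = hd p \<or> z = last p) \<longleftrightarrow>
      (\<forall>i<n. E y (p ! i) \<longleftrightarrow> i = 0 \<or> Suc i = n)" if "distinct p"
  proof -
    have "p ! i = hd p \<longleftrightarrow> i = 0" "p ! i = last p \<longleftrightarrow> Suc i = n" if "i < n" for i
      unfolding h using that n nth_eq_iff_index_eq[OF \<open>distinct p\<close>, of i 0]
       nth_eq_iff_index_eq[OF \<open>distinct p\<close>, of i "n - 1"] \<open>p \<noteq> []\<close> by auto
    then show ?thesis unfolding all_set_conv_all_nth n(1) by blast
  qed
  have s: "E (p ! i) y \<longleftrightarrow> E y (p ! i)" for i using assms(1) by (metis sympD)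
  have "(\<forall>i<Suc n. \<forall>j<Suc n. E ((y # p) ! i) ((y # p) ! j) \<longleftrightarrow> j = Suc i mod Suc n \<or> i = Suc j mod Suc n) \<longleftrightarrow>
     (\<forall>i<n. E y (p ! i) \<longleftrightarrow> i = 0 \<or> Suc i = n) \<and>
     (\<forall>i<n. \<forall>j<n. E (p ! i) (p ! j) \<longleftrightarrow> j = Suc i \<or> i = Suc j)"
  proof -
    have a: "(Suc j = Suc 0 mod Suc n \<or> 0 = Suc (Suc j) mod Suc n) \<longleftrightarrow> j = 0 \<or> Suc j = n" if "j < n" for j
      using that n(2) Suc_mod_less[of "Suc j" "Suc n"] by (simp del: mod_Suc; linarith)
    have b: "(Suc j = Suc (Suc i) mod Suc n \<or> Suc i = Suc (Suc j) mod Suc n) \<longleftrightarrow> j = Suc i \<or> i = Suc j" if "i < n" "j < n" for i j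
      using that n(2) Suc_mod_less[of "Suc i" "Suc n"] Suc_mod_less[of "Suc j" "Suc n"] by (simp del: mod_Suc; linarith)
    have c: "(0 = Suc 0 mod Suc n \<or> 0 = Suc 0 mod Suc n) \<longleftrightarrow> False" using n(2) by simp
    have d: "(0 = Suc (Suc j) mod Suc n \<or> Suc j = Suc 0 mod Suc n) \<longleftrightarrow> j = 0 \<or> Suc j = n" if "j < n" for j
      using a[OF that] by blast
    have "(\<forall>j<n. E y (p ! j) = (Suc j = Suc 0 mod Suc n \<or> 0 = Suc (Suc j) mod Suc n)) \<longleftrightarrow>
      (\<forall>i<n. E y (p ! i) \<longleftrightarrow> i = 0 \<or> Suc i = n)"
      by (simp only: a cong: imp_cong)
    moreover have "(\<forall>j<n. E y (p ! j) = (0 = Suc (Suc j) mod Suc n \<or> Suc j = Suc 0 mod Suc n)) \<longleftrightarrow>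
      (\<forall>i<n. E y (p ! i) \<longleftrightarrow> i = 0 \<or> Suc i = n)"
      by (simp only: d cong: imp_cong)
    moreover have "(\<forall>i<n. \<forall>j<n. E (p ! i) (p ! j) =
        (Suc j = Suc (Suc i) mod Suc n \<or> Suc i = Suc (Suc j) mod Suc n)) \<longleftrightarrow>
      (\<forall>i<n. \<forall>j<n. E (p ! i) (p ! j) \<longleftrightarrow> j = Suc i \<or> i = Suc j)"
      by (simp only: b cong: imp_cong)
    ultimately show ?thesis
      unfolding all_less_Suc_pair nth_Cons_0 nth_Cons_Suc s c
      using irreflpD[OF assms(2), of y] by argo
  qed
  then show ?thesis
    unfolding icycle_def ipath_nth[OF assms(1,2)] n(1)[symmetric] distinct.simps using hl n(2) by blast
qed

lemma chordless_cycle_iff: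
  assumes "simple_graph G"
  shows "chordless_cycle G (y # p) \<longleftrightarrow> icycle (adj G) y p \<and> insert y (set p) \<subseteq> fst G"
proof (cases "length p \<ge> 2")
  case True
  then have "length (y # p) \<ge> 3" by simp
  then show ?thesis
    unfolding chordless_cycle_def icycle_nth[OF symp_adj irreflp_adj[OF assms] refl True]
      adj_def[symmetric] list.set list.size add_Suc_right add_0_right by blast
next
  case False
  then show ?thesis by (simp add: chordless_cycle_def icycle_def)
qed

section \<open>Cyclic orientations exclude bad pairs\<close>

definition attached :: "'a graph \<Rightarrow> 'a set \<Rightarrow> 'a \<Rightarrow> bool" where
  "attached G Q x \<longleftrightarrow> (\<exists>q\<in>Q. adj G x q)"

text \<open>In a triangle only the first alternative can hold, all pairs being adjacent; on a longer
  chordless cycle the first alternative implies the second.\<close>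

definition bad_pair :: "'a graph \<Rightarrow> 'a \<Rightarrow> 'a list \<Rightarrow> 'a set \<Rightarrow> bool" where
  "bad_pair G y p Q \<longleftrightarrow> icycle (adj G) y p \<and> insert y (set p) \<subseteq> fst G \<and>
     conn (adj G) Q \<and> Q \<subseteq> fst G \<and> Q \<inter> insert y (set p) = {} \<and>
     ((\<forall>x\<in>insert y (set p). attached G Q x) \<or>
      (\<exists>x\<in>insert y (set p). \<exists>z\<in>insert y (set p). x \<noteq> z \<and> \<not> adj G x z \<and> attached G Q x \<and> attached G Q z))"

lemma adj_orientation:
  assumes "is_orientation G D" "adj G x y"
  shows "(x, y) \<in> D \<longleftrightarrow> (y, x) \<notin> D"
  using assms by (auto simp: is_orientation_def adj_def)

lemma last_in_set_tl: "length p \<ge> 2 \<Longrightarrow> last p \<in> set (tl p)"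
  by (cases p; cases "tl p") auto

lemma hd_in_set_butlast: "length p \<ge> 2 \<Longrightarrow> hd p \<in> set (butlast p)"
  by (cases p; cases "tl p") auto

lemma ipath_distinct: "ipath E p \<Longrightarrow> distinct p"
  by (induction p) auto

lemma ipath_tl: "ipath E p \<Longrightarrow> ipath E (tl p)"
  by (cases p) auto

lemma ipath_butlast: "ipath E p \<Longrightarrow> ipath E (butlast p)"
  by (cases p rule: rev_cases) (auto simp: ipath_append)

text \<open>Outside its context the locale predicate serves as the relation between a graph and an
  orientation of the desired kind.\<close>

locale cyclic_orientation =
  fixes G :: "'a graph" and D :: "('a \<times> 'a) set"
  assumes G: "simple_graph G" and D: "is_orientation G D"
    and cyc: "chordless_cycle G cs \<Longrightarrow> cyclically_oriented D cs"
begin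

text \<open>A shortest path from \<open>s\<close> to \<open>t\<close> inside \<open>T\<close> closes up through \<open>y\<close> to a chordless cycle.\<close>

lemma turn:
  assumes T: "conn (adj G) T" "T \<subseteq> fst G" "y \<notin> T" "s \<in> T" "t \<in> T" "s \<noteq> t"
    and nb: "\<And>z. z \<in> T \<Longrightarrow> adj G y z \<longleftrightarrow> z = s \<or> z = t"
  shows "(s, y) \<in> D \<longleftrightarrow> (y, t) \<in> D"
proof -
  obtain p where p: "ipath (adj G) p" "p \<noteq> []" "hd p = s" "last p = t" "set p \<subseteq> T"
    using conn_ipath[OF symp_adj T(1) T(4,5)] .
  have len: "length p \<ge> 2" using p \<open>s \<noteq> t\<close> by (cases p; cases "tl p") auto
  have "icycle (adj G) y p"
    unfolding icycle_def using len p nb T(3) by blast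
  moreover have "y \<in> fst G" using nb[OF T(4)] adj_in_verts[OF G] by blast
  ultimately have "cyclically_oriented D (y # p)"
    using cyc chordless_cycle_iff[OF G] p(5) T(2) by blast
  then consider
      "\<And>i. i < Suc (length p) \<Longrightarrow> ((y # p) ! i, (y # p) ! (Suc i mod Suc (length p))) \<in> D"
    | "\<And>i. i < Suc (length p) \<Longrightarrow> ((y # p) ! (Suc i mod Suc (length p)), (y # p) ! i) \<in> D"
    unfolding cyclically_oriented_def by auto
  \<comment> \<open>The cycle neighbours of \<open>y\<close> sit at positions 1 and
    \<open>length p\<close>; the latter wraps around to \<open>y\<close>.\<close>
  moreover have "(y # p) ! (Suc 0 mod Suc (length p)) = s"
    using len p by (simp add: hd_conv_nth)
  moreover have "(y # p) ! length p = t" using p len by (simp add: last_conv_nth nth_Cons')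
  ultimately have "((y, s) \<in> D \<and> (t, y) \<in> D) \<or> ((s, y) \<in> D \<and> (y, t) \<in> D)"
    by (metis lessI mod_self nth_Cons_0 zero_less_Suc)
  then show ?thesis
    using adj_orientation[OF D, of y s] adj_orientation[OF D, of y t] nb[OF T(4)] nb[OF T(5)] by blast
qed

text \<open>Of any two edges from \<open>y\<close> to \<open>hd p\<close>, \<open>last p\<close> and
  \<open>r\<close>, one enters \<open>y\<close> and the other leaves it, by \<open>turn\<close>;
  three edges cannot be pairwise opposite. The attachments \<open>x\<close> and \<open>z\<close>
  join \<open>Q\<close> to the path without its last, respectively its first, vertex.\<close>

lemma no_unique_attachment:
  assumes c: "icycle (adj G) y p" "insert y (set p) \<subseteq> fst G"
    and Q: "conn (adj G) Q" "Q \<subseteq> fst G" "Q \<inter> insert y (set p) = {}"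
    and r: "r \<in> Q" "\<And>z. z \<in> Q \<Longrightarrow> adj G y z \<longleftrightarrow> z = r"
    and x: "x \<in> set (butlast p)" "attached G Q x" and z: "z \<in> set (tl p)" "attached G Q z"
  shows False
proof -
  have p: "length p \<ge> 2" "y \<notin> set p" "ipath (adj G) p"
      "\<And>z. z \<in> set p \<Longrightarrow> adj G y z \<longleftrightarrow> z = hd p \<or> z = last p"
    using c(1) unfolding icycle_def by blast+
  obtain s q l where sq: "p = s # q @ [l]"
    using p(1) by (cases p; cases "tl p" rule: rev_cases) auto
  have d: "distinct p" using ipath_distinct p(3) by blast
  have b: "set (butlast p) \<subseteq> set p" "set (tl p) \<subseteq> set p" unfolding sq by auto
  have l: "last p \<notin> set (butlast p)" "hd p \<notin> set (tl p)" using d unfolding sq by auto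
  have hl: "hd p \<in> set p" "last p \<in> set p" unfolding sq by auto
  have ne: "hd p \<noteq> last p" using l(2) last_in_set_tl[OF p(1)] by metis
  have yQ: "y \<notin> Q" using Q(3) by blast
  \<comment> \<open>With \<open>last p\<close> left out, \<open>hd p\<close> and \<open>r\<close>
    are the only neighbours of \<open>y\<close> in this set.\<close>
  have "conn (adj G) (set (butlast p) \<union> Q)"
    using conn_Un[OF symp_adj ipath_conn[OF symp_adj ipath_butlast[OF p(3)]] Q(1)] x unfolding attached_def by blast
  then have 1: "(hd p, y) \<in> D \<longleftrightarrow> (y, r) \<in> D"
    apply (rule turn)
    using c(2) b Q hd_in_set_butlast[OF p(1)] r p(2) hl p(4) l by auto
  have "conn (adj G) (set (tl p) \<union> Q)"
    using conn_Un[OF symp_adj ipath_conn[OF symp_adj ipath_tl[OF p(3)]] Q(1)] z unfolding attached_def by blast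
  then have 2: "(last p, y) \<in> D \<longleftrightarrow> (y, r) \<in> D"
    apply (rule turn)
    using c(2) b Q last_in_set_tl[OF p(1)] r p(2) hl p(4) l by auto
  have 3: "(hd p, y) \<in> D \<longleftrightarrow> (y, last p) \<in> D"
    using turn[OF ipath_conn[OF symp_adj p(3)] _ p(2) hl ne p(4)] c(2) by blast
  show False using 1 2 3 adj_orientation[OF D, of y "last p"] p(4)[OF hl(2)] by blast
qed

text \<open>Shrinking \<open>Q\<close> to an induced path from a neighbour of \<open>x\<close>
  towards \<open>y\<close> leaves \<open>y\<close> a unique neighbour in it.\<close>

lemma no_nonadjacent_attachments:
  assumes c: "icycle (adj G) y p" "insert y (set p) \<subseteq> fst G"
    and Q: "conn (adj G) Q" "Q \<subseteq> fst G" "Q \<inter> insert y (set p) = {}"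
    and x: "x \<in> set p" "\<not> adj G y x" "attached G Q x" "attached G Q y"
  shows False
proof -
  obtain a b where a: "a \<in> Q" "adj G x a" and b: "b \<in> Q" "adj G y b"
    using x unfolding attached_def by blast
  have "conn (adj G) (insert y Q)" using conn_insert[OF symp_adj Q(1) b] .
  then obtain q where q: "ipath (adj G) q" "q \<noteq> []" "hd q = a" "last q = y" "set q \<subseteq> insert y Q"
    by (rule conn_ipath[OF symp_adj, of G "insert y Q" a y]) (use a in auto)
  \<comment> \<open>Since \<open>q\<close> is induced and ends in \<open>y\<close>, only the vertex
    just before \<open>y\<close> sees \<open>y\<close>.\<close>
  define q' where "q' = butlast q"
  have qq: "q = q' @ [y]" using q unfolding q'_def by (metis append_butlast_last_id)
  have "a \<noteq> y" using a Q(3) by blast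
  then have "q' \<noteq> []" using qq q(3) by (cases q') auto
  have q': "ipath (adj G) q'" "y \<notin> set q'" "\<And>z. z \<in> set q' \<Longrightarrow> adj G z y \<longleftrightarrow> z = last q'"
    using q(1) unfolding qq ipath_append by auto
  have sub: "set q' \<subseteq> Q" using q(5) q'(2) qq by auto
  have p: "length p \<ge> 2" "\<And>z. z \<in> set p \<Longrightarrow> adj G y z \<longleftrightarrow> z = hd p \<or> z = last p"
    using c(1) unfolding icycle_def by blast+
  have "x \<noteq> hd p" "x \<noteq> last p" using x p(2) by blast+
  obtain u v w where "p = u # v @ [w]"
    using p(1) by (cases p; cases "tl p" rule: rev_cases) auto
  \<comment> \<open>Being neither end of \<open>p\<close>, the vertex \<open>x\<close> can serve as
    both attachments of \<open>no_unique_attachment\<close>.\<close>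
  with \<open>x \<noteq> hd p\<close> \<open>x \<noteq> last p\<close> have xx: "x \<in> set (butlast p)" "x \<in> set (tl p)"
    using x(1) by auto
  have "attached G (set q') x"
    unfolding attached_def using a(2) \<open>q' \<noteq> []\<close> q(3) qq by (metis hd_append2 hd_in_set)
  then show False
    using no_unique_attachment[OF c ipath_conn[OF symp_adj q'(1)] _ _ last_in_set[OF \<open>q' \<noteq> []\<close>] _ xx(1) _ xx(2)]
      sub Q q'(3) adj_commute[of G y] by blast
qed

text \<open>Remove a non-cut vertex \<open>r\<close> from \<open>Q\<close>. Either all three
  attachments survive and induction applies, or \<open>r\<close> was the only neighbour in
  \<open>Q\<close> of some triangle vertex, which \<open>no_unique_attachment\<close>
  excludes.\<close>

lemma no_attached_triangle:
  assumes t: "adj G x y" "adj G y z" "adj G x z"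
    and Q: "conn (adj G) Q" "Q \<subseteq> fst G" "Q \<inter> {x, y, z} = {}"
    and a: "attached G Q x" "attached G Q y" "attached G Q z"
  shows False
  using Q a
proof (induction "card Q" arbitrary: Q rule: less_induct)
  case less
  have V: "x \<in> fst G" "y \<in> fst G" "z \<in> fst G" using t adj_in_verts[OF G] by blast+
  have fin: "finite Q" using less.prems(2) G by (auto simp: simple_graph_def dest: finite_subset)
  \<comment> \<open>The triangle is read as base \<open>a\<close> with path \<open>[b, c]\<close>,
    so \<open>b\<close> and \<open>c\<close> are the attachments on the two shortened paths.\<close>
  have unique: False if "adj G a b" "adj G a c" "adj G b c" "{a, b, c} = {x, y, z}"
     "r \<in> Q" "\<And>w. w \<in> Q \<Longrightarrow> adj G a w \<longleftrightarrow> w = r" for a b c r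
  proof -
    have n: "a \<noteq> b" "a \<noteq> c" "b \<noteq> c" using that adj_irrefl[OF G] by auto
    have "icycle (adj G) a [b, c]" using that(1-3) n by (simp add: icycle_def)
    moreover have "\<forall>w\<in>{a, b, c}. attached G Q w \<and> w \<in> fst G" unfolding that(4) using less.prems(4-6) V by simp
    moreover have "Q \<inter> insert a (set [b, c]) = {}" using less.prems(3) that(4) by simp
    ultimately show False
      using no_unique_attachment[of a "[b, c]" Q r b c, OF _ _ less.prems(1,2) _ that(5,6)] by simp
  qed
  show False
  proof (cases "\<exists>q. Q = {q}")
    case True
    then obtain q where "Q = {q}" by blast
    then show False using unique[of x y z q] t less.prems by (auto simp: attached_def)
  next
    case False
    obtain q where "q \<in> Q" using less.prems(4) unfolding attached_def by blast
    then obtain r where r: "r \<in> Q" "conn (adj G) (Q - {r})" "Q - {r} \<noteq> {}"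
      using conn_delete_vertex[OF symp_adj fin less.prems(1)] False by metis
    have "attached G (Q - {r}) a" if "a \<in> {x, y, z}" for a
    proof (rule ccontr)
      assume n: "\<not> attached G (Q - {r}) a"
      have "attached G Q a" using that less.prems by blast
      then have "\<And>w. w \<in> Q \<Longrightarrow> adj G a w \<longleftrightarrow> w = r" using n unfolding attached_def by blast
      then show False using that unique[of x y z r] unique[of y x z r] unique[of z x y r] t r(1) adj_sym[of G] by blast
    qed
    moreover have "card (Q - {r}) < card Q" using r(1) fin by (rule card_Diff1_less[rotated])
    ultimately show False using less.hyps[of "Q - {r}"] r less.prems by blast
  qed
qed

lemma no_bad_pair: "\<not> bad_pair G y p Q"
proof
  assume "bad_pair G y p Q"
  then have c: "icycle (adj G) y p" "insert y (set p) \<subseteq> fst G"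
    and Q: "conn (adj G) Q" "Q \<subseteq> fst G" "Q \<inter> insert y (set p) = {}"
    and a: "(\<forall>x\<in>insert y (set p). attached G Q x) \<or>
      (\<exists>x\<in>insert y (set p). \<exists>z\<in>insert y (set p). x \<noteq> z \<and> \<not> adj G x z \<and> attached G Q x \<and> attached G Q z)"
    by (simp_all only: bad_pair_def)
  have pair: False if h: "x \<in> insert y (set p)" "z \<in> insert y (set p)" "x \<noteq> z" "\<not> adj G x z"
      "attached G Q x" "attached G Q z" for x z
  proof -
    obtain p' where p': "icycle (adj G) x p'" "insert x (set p') = insert y (set p)"
      using icycle_rotate[OF symp_adj c(1) h(1)] .
    have "z \<in> insert x (set p')" unfolding p'(2) by (fact h(2))
    then have "z \<in> set p'" using h(3) by simp
    show False
    proof (rule no_nonadjacent_attachments[OF p'(1) _ Q(1,2) _ \<open>z \<in> set p'\<close> h(4)])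
      show "insert x (set p') \<subseteq> fst G" "Q \<inter> insert x (set p') = {}"
        unfolding p'(2) by fact+
    qed (use h in simp_all)
  qed
  \<comment> \<open>The second alternative is already refuted by \<open>pair\<close>, so the whole
    cycle is attached. Another use of \<open>pair\<close> makes all its vertices pairwise adjacent,
    and the cycle is a triangle.\<close>
  have all: "\<forall>x\<in>insert y (set p). attached G Q x"
    using a
  proof
    assume "\<exists>x\<in>insert y (set p). \<exists>z\<in>insert y (set p). x \<noteq> z \<and> \<not> adj G x z \<and> attached G Q x \<and> attached G Q z"
    then show ?thesis using pair by metis
  qed
  have p: "length p \<ge> 2" "ipath (adj G) p" "\<And>z. z \<in> set p \<Longrightarrow> adj G y z \<longleftrightarrow> z = hd p \<or> z = last p"
    using c(1) unfolding icycle_def by blast+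
  obtain s t q where st: "p = s # t # q" using p(1) by (cases p; cases "tl p") auto
  have mem: "s \<in> set p" "t \<in> set p" "last p \<in> set p" "last p \<in> set (t # q)" unfolding st by simp_all
  have sn: "s \<notin> set (t # q)" "\<forall>z\<in>set (t # q). adj G s z \<longleftrightarrow> z = t" using p(2) unfolding st by simp_all
  have "s \<noteq> last p" using sn(1) mem(4) by blast
  \<comment> \<open>On the induced path \<open>s\<close> sees only \<open>t\<close>, so adjacency to
    \<open>last p\<close> forces \<open>last p = t\<close>.\<close>
  then have sl: "adj G s (last p)" using pair[of s "last p"] all mem by blast
  then have l: "last p = t" using sn(2) mem(4) by blast
  have "hd p = s" unfolding st by simp
  then have "adj G y s" "adj G s t" "adj G y t" using sl l p(3) mem by simp_all
  moreover have "Q \<inter> {y, s, t} = {}" using Q(3) st by auto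
  ultimately show False using no_attached_triangle[of y s t Q] Q(1,2) all st by simp
qed

end

section \<open>Minor models\<close>

lemma adj_delete_vertex: "adj (delete_vertex v G) x y \<longleftrightarrow> adj G x y \<and> x \<noteq> v \<and> y \<noteq> v"
  by (auto simp: adj_def delete_vertex_def)

lemma simple_graph_delete_vertex: "simple_graph G \<Longrightarrow> simple_graph (delete_vertex v G)"
  by (auto simp: simple_graph_def delete_vertex_def)

definition merge :: "'a \<Rightarrow> 'a \<Rightarrow> 'a \<Rightarrow> 'a" where
  "merge u v x = (if x = v then u else x)"

text \<open>Contraction is the quotient by \<open>merge u v\<close> with loops dropped. This
  symmetric form replaces the set description of the new edges in all later arguments.\<close>

lemma adj_contract_edge:
  assumes "simple_graph G" "u \<noteq> v"
  shows "adj (contract_edge u v G) x y \<longleftrightarrow> x \<noteq> y \<and> (\<exists>a b. merge u v a = x \<and> merge u v b = y \<and> adj G a b)"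
    (is "?L \<longleftrightarrow> ?R")
proof
  assume ?L
  then consider "adj G x y" "v \<noteq> x" "v \<noteq> y" | w where "{x, y} = {u, w}" "adj G v w" "w \<noteq> u"
    by (auto simp: adj_def contract_edge_def)
  then show ?R
  proof cases
    case 1
    then have "merge u v x = x" "merge u v y = y" by (simp_all add: merge_def)
    moreover have "x \<noteq> y" using 1(1) adj_irrefl[OF assms(1)] by blast
    ultimately show ?thesis using 1(1) by blast
  next
    case 2
    then have "w \<noteq> v" using adj_irrefl[OF assms(1)] by blast
    then have "merge u v w = w" "merge u v v = u" by (simp_all add: merge_def)
    moreover have "x = u \<and> y = w \<or> x = w \<and> y = u" using 2(1) by (simp add: doubleton_eq_iff)
    ultimately show ?thesis using 2(2,3) adj_sym[OF 2(2)] by metis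
  qed
next
  assume ?R
  then obtain a b where ab: "x \<noteq> y" "merge u v a = x" "merge u v b = y" "adj G a b" by blast
  consider "a = v" | "b = v" | "a \<noteq> v" "b \<noteq> v" by blast
  then show ?L
  proof cases
    case 1
    then have "x = u" "y = b" "b \<noteq> u" using ab by (auto simp: merge_def split: if_splits)
    then show ?thesis using ab 1 by (auto simp: adj_def contract_edge_def)
  next
    case 2
    then have "y = u" "x = a" "a \<noteq> u" using ab by (auto simp: merge_def split: if_splits)
    then show ?thesis using adj_sym[OF ab(4)] 2 by (auto simp: adj_def contract_edge_def insert_commute)
  next
    case 3
    then show ?thesis using ab by (auto simp: adj_def contract_edge_def merge_def)
  qed
qed

lemma fst_contract_edge [simp]: "fst (contract_edge u v G) = fst G - {v}"
  by (simp add: contract_edge_def)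

lemma fst_delete_vertex [simp]: "fst (delete_vertex v G) = fst G - {v}"
  by (simp add: delete_vertex_def)

lemma simple_graph_contract_edge:
  assumes "simple_graph G" "adj G u v"
  shows "simple_graph (contract_edge u v G)"
proof -
  have "u \<noteq> v" "u \<in> fst G" using assms adj_irrefl adj_in_verts by metis+
  moreover have "w \<in> fst G \<and> w \<noteq> v" if "{v, w} \<in> snd G" for w
    using that assms(1) adj_irrefl[of G v] adj_in_verts[of G v w] by (auto simp: adj_def)
  ultimately show ?thesis using assms(1) by (auto simp: simple_graph_def contract_edge_def)
qed

lemma simple_graph_minor_step:
  "minor_step G G' \<Longrightarrow> simple_graph G \<Longrightarrow> simple_graph G'"
  by (induction rule: minor_step.induct)
     (auto simp: simple_graph_delete_vertex adj_def intro!: simple_graph_contract_edge)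

lemma induced_minor_minor_step:
  "minor_step G G' \<Longrightarrow> induced_minor H G' \<Longrightarrow> induced_minor H G"
  unfolding induced_minor_def by (meson converse_rtranclp_into_rtranclp)

section \<open>Branch set models of induced minors\<close>

text \<open>The \<open>B i\<close> are branch sets. For an induced minor, bags of nonadjacent
  vertices must have no edge between them; vertices outside all bags are allowed and get
  deleted.\<close>

definition minor_model :: "'b graph \<Rightarrow> ('b \<Rightarrow> 'a set) \<Rightarrow> 'a graph \<Rightarrow> bool" where
  "minor_model H B G \<longleftrightarrow>
     (\<forall>i\<in>fst H. B i \<noteq> {} \<and> conn (adj G) (B i) \<and> B i \<subseteq> fst G) \<and>
     (\<forall>i\<in>fst H. \<forall>j\<in>fst H. i \<noteq> j \<longrightarrow> B i \<inter> B j = {} \<and>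
        ((\<exists>x\<in>B i. \<exists>y\<in>B j. adj G x y) \<longleftrightarrow> adj H i j))"

lemma minor_model_delete_vertex:
  assumes m: "minor_model H B G" and v: "\<And>i. i \<in> fst H \<Longrightarrow> v \<notin> B i"
  shows "minor_model H B (delete_vertex v G)"
proof -
  have "conn (adj (delete_vertex v G)) (B i)" if "i \<in> fst H" for i
  proof -
    have "conn (adj G) (B i)" using m that unfolding minor_model_def by blast
    then show ?thesis
      by (rule conn_cong[THEN iffD1, rotated]) (auto simp: adj_delete_vertex v[OF that])
  qed
  moreover have "(\<exists>x\<in>B i. \<exists>y\<in>B j. adj (delete_vertex v G) x y) \<longleftrightarrow> (\<exists>x\<in>B i. \<exists>y\<in>B j. adj G x y)"
    if "i \<in> fst H" "j \<in> fst H" for i j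
    unfolding adj_delete_vertex using v[OF that(1)] v[OF that(2)] by blast
  moreover have "B i \<subseteq> fst G - {v}" if "i \<in> fst H" for i
    using m that v[OF that] unfolding minor_model_def by blast
  ultimately show ?thesis using m unfolding minor_model_def fst_delete_vertex by simp
qed

lemma minor_model_contract_edge:
  assumes G: "simple_graph G" and m: "minor_model H B G"
    and i: "i \<in> fst H" "u \<in> B i" "v \<in> B i" "adj G u v"
  shows "minor_model H (\<lambda>j. merge u v ` B j) (contract_edge u v G)"
proof -
  let ?G = "contract_edge u v G" let ?c = "merge u v"
  have uv: "u \<noteq> v" "u \<in> fst G" using i adj_irrefl[OF G] adj_in_verts[OF G] by blast+
  have dis: "B j \<inter> B j' = {}" if "j \<in> fst H" "j' \<in> fst H" "j \<noteq> j'" for j j'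
    using m that unfolding minor_model_def by blast
  \<comment> \<open>Only \<open>u\<close> and \<open>v\<close> are identified, and both lie in bag
    \<open>i\<close>, so membership in the image of a bag pulls back to the bag.\<close>
  have lift: "a \<in> B j" if h: "j \<in> fst H" "?c a \<in> ?c ` B j" for a j
  proof -
    obtain b where b: "b \<in> B j" "?c a = ?c b" using h(2) by blast
    then have "a = b \<or> (a \<in> {u, v} \<and> b \<in> {u, v})" by (auto simp: merge_def split: if_splits)
    then show ?thesis using b(1) dis[OF h(1) i(1)] i(2,3) by blast
  qed
  have adj: "adj ?G x y \<longleftrightarrow> x \<noteq> y \<and> (\<exists>a b. ?c a = x \<and> ?c b = y \<and> adj G a b)" for x y
    using adj_contract_edge[OF G uv(1)] .
  have 1: "conn (adj ?G) (?c ` B j)" if "j \<in> fst H" for j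
  proof (rule conn_image)
    show "conn (adj G) (B j)" using m that unfolding minor_model_def by blast
  qed (use adj in blast)
  have 2: "?c ` B j \<noteq> {}" "?c ` B j \<subseteq> fst G - {v}" if "j \<in> fst H" for j
  proof -
    have "B j \<noteq> {}" "B j \<subseteq> fst G" using m that unfolding minor_model_def by blast+
    then show "?c ` B j \<noteq> {}" "?c ` B j \<subseteq> fst G - {v}" using uv by (auto simp: merge_def)
  qed
  have 3: "?c ` B j \<inter> ?c ` B j' = {}" if "j \<in> fst H" "j' \<in> fst H" "j \<noteq> j'" for j j'
    using lift[OF that(2)] dis[OF that] by blast
  have 4: "(\<exists>x\<in>?c ` B j. \<exists>y\<in>?c ` B j'. adj ?G x y) \<longleftrightarrow> adj H j j'"
    if h: "j \<in> fst H" "j' \<in> fst H" "j \<noteq> j'" for j j'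
  proof -
    have "(\<exists>x\<in>?c ` B j. \<exists>y\<in>?c ` B j'. adj ?G x y) \<longleftrightarrow> (\<exists>x\<in>B j. \<exists>y\<in>B j'. adj G x y)"
    proof
      assume "\<exists>x\<in>?c ` B j. \<exists>y\<in>?c ` B j'. adj ?G x y"
      then obtain a b where "?c a \<in> ?c ` B j" "?c b \<in> ?c ` B j'" "adj G a b"
        unfolding adj by blast
      then show "\<exists>x\<in>B j. \<exists>y\<in>B j'. adj G x y" using lift h by blast
    next
      assume "\<exists>x\<in>B j. \<exists>y\<in>B j'. adj G x y"
      then obtain x y where xy: "x \<in> B j" "y \<in> B j'" "adj G x y" by blast
      then have "?c x \<noteq> ?c y" using 3[OF h] by blast
      then show "\<exists>x\<in>?c ` B j. \<exists>y\<in>?c ` B j'. adj ?G x y" unfolding adj using xy by blast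
    qed
    then show ?thesis using m h unfolding minor_model_def by blast
  qed
  show ?thesis
    unfolding minor_model_def fst_contract_edge
    by (intro conjI ballI impI) (rule 1 2 3 4; assumption)+
qed

text \<open>Delete a vertex outside all bags, or contract an edge inside a bag with more than one
  vertex; each step lowers the vertex count. When neither is possible, the bags are singletons
  covering the graph, which is then isomorphic to \<open>H\<close>.\<close>

lemma minor_model_induced_minor:
  assumes "simple_graph G" "simple_graph H" "minor_model H B G"
  shows "induced_minor H G"
  using assms(1,3)
proof (induction "card (fst G)" arbitrary: G B rule: less_induct)
  case less
  note G = less.prems(1) and m = less.prems(2)
  have fin: "finite (fst G)" using G by (simp add: simple_graph_def)
  have bag: "B i \<noteq> {}" "conn (adj G) (B i)" "B i \<subseteq> fst G" if "i \<in> fst H" for i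
    using m that unfolding minor_model_def by blast+
  consider (del) v where "v \<in> fst G" "\<And>i. i \<in> fst H \<Longrightarrow> v \<notin> B i"
    | (con) i where "i \<in> fst H" "\<nexists>x. B i = {x}"
    | (iso) "\<And>v. v \<in> fst G \<Longrightarrow> \<exists>i\<in>fst H. v \<in> B i" "\<And>i. i \<in> fst H \<Longrightarrow> \<exists>x. B i = {x}"
    by blast
  then show ?case
  proof cases
    case del
    have "card (fst (delete_vertex v G)) < card (fst G)"
      using card_Diff1_less[OF fin del(1)] by simp
    then have "induced_minor H (delete_vertex v G)"
      using less.hyps simple_graph_delete_vertex[OF G] minor_model_delete_vertex[OF m del(2)] by blast
    then show ?thesis using induced_minor_minor_step minor_step.del[OF del(1)] by blast
  next
    case con
    obtain x where x: "x \<in> B i" using bag[OF con(1)] by blast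
    \<comment> \<open>Connectivity of the bag, applied to the proper subset \<open>{x}\<close>,
      yields an edge to contract.\<close>
    have "{x} \<subseteq> B i" "{x} \<noteq> {}" "{x} \<noteq> B i" using x con(2) by auto
    from connD[OF bag(2)[OF con(1)] this] obtain u v where "u \<in> {x}" "v \<in> B i" "v \<notin> {x}" "adj G u v" .
    then have uv: "u \<in> B i" "v \<in> B i" "adj G u v" "u \<noteq> v" using x by auto
    have "v \<in> fst G" using uv(2) bag(3)[OF con(1)] by blast
    then have "card (fst (contract_edge u v G)) < card (fst G)"
      using card_Diff1_less[OF fin] by simp
    then have "induced_minor H (contract_edge u v G)"
      using less.hyps simple_graph_contract_edge[OF G uv(3)]
        minor_model_contract_edge[OF G m con(1) uv(1-3)] by blast
    moreover have "minor_step G (contract_edge u v G)"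
      by (rule minor_step.con) (use uv in \<open>simp_all add: adj_def\<close>)
    ultimately show ?thesis using induced_minor_minor_step by blast
  next
    case iso
    define g where "g = (\<lambda>i. THE x. B i = {x})"
    have g: "B i = {g i}" if "i \<in> fst H" for i
      using iso(2)[OF that] by (auto simp: g_def)
    have "inj_on g (fst H)"
      using m g unfolding minor_model_def inj_on_def by (metis insert_disjoint(1) insertI1)
    moreover have "g ` fst H = fst G"
      using iso(1) g bag(3) by fastforce
    ultimately have bij: "bij_betw g (fst H) (fst G)" by (simp add: bij_betw_def)
    \<comment> \<open>\<open>g\<close> sends each vertex of \<open>H\<close> to the element of its
      bag; the isomorphism has to run from \<open>G\<close> to \<open>H\<close>, hence the
      inverse.\<close>
    define f where "f = the_inv_into (fst H) g"
    have f: "bij_betw f (fst G) (fst H)" unfolding f_def using bij by (rule bij_betw_the_inv_into)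
    have gf: "g (f x) = x" "f x \<in> fst H" if "x \<in> fst G" for x
      using that bij f unfolding f_def by (auto simp: bij_betw_def f_the_inv_into_f)
    have "adj G x y \<longleftrightarrow> adj H (f x) (f y)" if "x \<in> fst G" "y \<in> fst G" for x y
    proof (cases "x = y")
      case True
      then show ?thesis using adj_irrefl[OF G] adj_irrefl[OF assms(2)] by simp
    next
      case False
      then have "f x \<noteq> f y" using gf(1)[OF that(1)] gf(1)[OF that(2)] by metis
      then have "(\<exists>a\<in>B (f x). \<exists>b\<in>B (f y). adj G a b) \<longleftrightarrow> adj H (f x) (f y)"
        using m gf(2)[OF that(1)] gf(2)[OF that(2)] unfolding minor_model_def by blast
      then show ?thesis using g[OF gf(2)[OF that(1)]] g[OF gf(2)[OF that(2)]] gf(1)[OF that(1)] gf(1)[OF that(2)] by simp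
    qed
    then have "graph_iso G H f" using f unfolding graph_iso_def adj_def by blast
    then show ?thesis unfolding induced_minor_def by blast
  qed
qed

section \<open>Bad pairs and the two excluded induced minors\<close>

definition bad :: "'a graph \<Rightarrow> bool" where
  "bad G \<longleftrightarrow> (\<exists>y p Q. bad_pair G y p Q)"

definition touch :: "'a graph \<Rightarrow> 'a set \<Rightarrow> 'a set \<Rightarrow> bool" where
  "touch G X Y \<longleftrightarrow> (\<exists>x\<in>X. \<exists>y\<in>Y. adj G x y)"

lemma touch_commute: "touch G X Y \<longleftrightarrow> touch G Y X"
  unfolding touch_def using adj_sym by metis

lemma touchI: "adj G x y \<Longrightarrow> x \<in> X \<Longrightarrow> y \<in> Y \<Longrightarrow> touch G X Y"
  unfolding touch_def by blast

definition bag :: "'a graph \<Rightarrow> 'a set \<Rightarrow> bool" where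
  "bag G X \<longleftrightarrow> X \<noteq> {} \<and> conn (adj G) X \<and> X \<subseteq> fst G"

lemma adj_K4: "adj K4 i j \<longleftrightarrow> i \<noteq> j \<and> i \<le> 3 \<and> j \<le> 3"
  by (auto simp: adj_def K4_def doubleton_eq_iff)

lemma fst_K4: "fst K4 = {0, 1, 2, 3}"
  by (auto simp: K4_def)

lemma adj_K23: "adj K23 i j \<longleftrightarrow> i \<in> {0, 1} \<and> j \<in> {2, 3, 4} \<or> j \<in> {0, 1} \<and> i \<in> {2, 3, 4}"
  by (auto simp: adj_def K23_def doubleton_eq_iff)

lemma fst_K23: "fst K23 = {0, 1, 2, 3, 4}"
  by (auto simp: K23_def)

lemma simple_graph_K4: "simple_graph K4"
  by (auto simp: simple_graph_def K4_def)

lemma simple_graph_K23: "simple_graph K23"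
  by (auto simp: simple_graph_def K23_def)

lemma K4_bags:
  assumes "simple_graph G" and b: "bag G A" "bag G B" "bag G C" "bag G D"
    and d: "A \<inter> B = {}" "A \<inter> C = {}" "A \<inter> D = {}" "B \<inter> C = {}" "B \<inter> D = {}" "C \<inter> D = {}"
    and t: "touch G A B" "touch G A C" "touch G A D" "touch G B C" "touch G B D" "touch G C D"
  shows "induced_minor K4 G"
proof -
  \<comment> \<open>A model is checked on ordered pairs of bags, so simplification needs each fact
    in both orders.\<close>
  have t': "touch G B A" "touch G C A" "touch G D A" "touch G C B" "touch G D B" "touch G D C"
    using t touch_commute by metis+
  have d': "B \<inter> A = {}" "C \<inter> A = {}" "D \<inter> A = {}" "C \<inter> B = {}" "D \<inter> B = {}" "D \<inter> C = {}"
    using d by (simp_all add: Int_commute)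
  have "minor_model K4 (\<lambda>i. [A, B, C, D] ! i) G"
    unfolding minor_model_def touch_def[symmetric] bag_def[symmetric] fst_K4 adj_K4
    by (simp add: b t t' d d')
  then show ?thesis using minor_model_induced_minor[OF assms(1) simple_graph_K4] by blast
qed

text \<open>\<open>A\<close> and \<open>B\<close> form the side of size two, and \<open>C\<close>,
  \<open>D\<close>, \<open>E\<close> the side of size three.\<close>

lemma K23_bags:
  assumes "simple_graph G" and b: "bag G A" "bag G B" "bag G C" "bag G D" "bag G E"
    and d: "A \<inter> B = {}" "A \<inter> C = {}" "A \<inter> D = {}" "A \<inter> E = {}" "B \<inter> C = {}" "B \<inter> D = {}" "B \<inter> E = {}"
      "C \<inter> D = {}" "C \<inter> E = {}" "D \<inter> E = {}"
    and t: "touch G A C" "touch G A D" "touch G A E" "touch G B C" "touch G B D" "touch G B E"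
    and n: "\<not> touch G A B" "\<not> touch G C D" "\<not> touch G C E" "\<not> touch G D E"
  shows "induced_minor K23 G"
proof -
  have t': "touch G C A" "touch G D A" "touch G E A" "touch G C B" "touch G D B" "touch G E B"
    and n': "\<not> touch G B A" "\<not> touch G D C" "\<not> touch G E C" "\<not> touch G E D"
    using t n touch_commute by metis+
  have d': "B \<inter> A = {}" "C \<inter> A = {}" "D \<inter> A = {}" "E \<inter> A = {}" "C \<inter> B = {}" "D \<inter> B = {}" "E \<inter> B = {}"
     "D \<inter> C = {}" "E \<inter> C = {}" "E \<inter> D = {}"
    using d by (simp_all add: Int_commute)
  have "minor_model K23 (\<lambda>i. [A, B, C, D, E] ! i) G"
    unfolding minor_model_def touch_def[symmetric] bag_def[symmetric] fst_K23 adj_K23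
    by (simp add: b t t' d d' n n')
  then show ?thesis using minor_model_induced_minor[OF assms(1) simple_graph_K23] by blast
qed

lemma bag_singleton: "x \<in> fst G \<Longrightarrow> bag G {x}"
  by (simp add: bag_def)

lemma bag_ipath: "ipath (adj G) p \<Longrightarrow> p \<noteq> [] \<Longrightarrow> set p \<subseteq> fst G \<Longrightarrow> bag G (set p)"
  by (simp add: bag_def ipath_conn symp_adj)

lemma attached_nonempty: "attached G Q x \<Longrightarrow> Q \<noteq> {}"
  by (auto simp: attached_def)

lemma touch_attached: "attached G Q x \<Longrightarrow> x \<in> X \<Longrightarrow> touch G X Q"
  by (auto simp: attached_def touch_def)

text \<open>If everything is attached, the cycle is cut into three arcs that together with
  \<open>Q\<close> form a \<open>K4\<close> model. For nonadjacent attachments \<open>x\<close> and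
  \<open>z\<close>, the outcome depends on whether \<open>Q\<close> touches the interior of one of
  the two arcs between them.\<close>

lemma bad_induced_minor:
  assumes G: "simple_graph G" and "bad G"
  shows "induced_minor K4 G \<or> induced_minor K23 G"
proof -
  obtain y p Q where "bad_pair G y p Q" using assms(2) unfolding bad_def by blast
  then have c: "icycle (adj G) y p" "insert y (set p) \<subseteq> fst G"
    and Q: "conn (adj G) Q" "Q \<subseteq> fst G" "Q \<inter> insert y (set p) = {}"
    and a: "(\<forall>x\<in>insert y (set p). attached G Q x) \<or>
      (\<exists>x\<in>insert y (set p). \<exists>z\<in>insert y (set p). x \<noteq> z \<and> \<not> adj G x z \<and> attached G Q x \<and> attached G Q z)"
    by (simp_all only: bad_pair_def)
  have bagQ: "bag G Q" if "attached G Q x" for x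
    using Q(1,2) attached_nonempty[OF that] by (simp add: bag_def)
  from a show ?thesis
  proof
    assume all: "\<forall>x\<in>insert y (set p). attached G Q x"
    have p: "length p \<ge> 2" "y \<notin> set p" "ipath (adj G) p"
       "\<forall>z\<in>set p. adj G y z \<longleftrightarrow> z = hd p \<or> z = last p"
      using c(1) unfolding icycle_def by blast+
    obtain s t q where st: "p = s # t # q" using p(1) by (cases p; cases "tl p") auto
    have "adj G y s" "adj G y (last p)" using p(4) unfolding st by auto
    moreover have "adj G s t" "ipath (adj G) (t # q)" "s \<notin> set (t # q)" using p(3) unfolding st by auto
    moreover have "last p \<in> set (t # q)" unfolding st by simp
    ultimately have "induced_minor K4 G"
      using c(2) Q(3) p(2) all
      by (intro K4_bags[OF G, of "{y}" "{s}" "set (t # q)" Q] bag_singleton bag_ipath bagQ[of y])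
         (auto simp: st intro: touchI touch_attached)
    then show ?thesis ..
  next
    assume "\<exists>x\<in>insert y (set p). \<exists>z\<in>insert y (set p). x \<noteq> z \<and> \<not> adj G x z \<and> attached G Q x \<and> attached G Q z"
    then obtain x z where xz: "x \<in> insert y (set p)" "z \<in> insert y (set p)" "x \<noteq> z" "\<not> adj G x z"
      "attached G Q x" "attached G Q z" by blast
    obtain p' where p': "icycle (adj G) x p'" "insert x (set p') = insert y (set p)"
      using icycle_rotate[OF symp_adj c(1) xz(1)] .
    have "z \<in> insert x (set p')" unfolding p'(2) by (fact xz(2))
    then have zp: "z \<in> set p'" using xz(3) by simp
    have p: "length p' \<ge> 2" "x \<notin> set p'" "ipath (adj G) p'"
       "\<forall>z\<in>set p'. adj G x z \<longleftrightarrow> z = hd p' \<or> z = last p'"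
      using p'(1) unfolding icycle_def by blast+
    have V: "x \<in> fst G" "set p' \<subseteq> fst G" "x \<notin> Q" "Q \<inter> set p' = {}"
      using c(2) Q(3) unfolding p'(2)[symmetric] by auto
    obtain p1 p2 where sp: "p' = p1 @ z # p2" using zp by (meson split_list)
    \<comment> \<open>\<open>z\<close> is not a cycle neighbour of \<open>x\<close>, so both open
      arcs between them are nonempty.\<close>
    have ne: "p1 \<noteq> []" "p2 \<noteq> []" using p(4) zp xz(4) unfolding sp by auto
    have e1: "adj G x (hd p1)" "adj G x (last p2)" using p(4) ne unfolding sp by auto
    have ip: "ipath (adj G) p1" "ipath (adj G) (z # p2)" "ipath (adj G) p2" "ipath (adj G) (p1 @ [z])"
      and d: "set p1 \<inter> set p2 = {}" "z \<notin> set p1" "z \<notin> set p2"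
      and e2: "adj G (last p1) z" "adj G z (hd p2)" and no: "\<not> touch G (set p1) (set p2)"
      using p(3) ne unfolding sp ipath_append touch_def by auto
    have mem: "hd p1 \<in> set p1" "last p1 \<in> set p1" "hd p2 \<in> set p2" "last p2 \<in> set p2" using ne by auto
    have x: "x \<notin> set p1" "x \<notin> set p2" "x \<noteq> z" using p(2) unfolding sp by auto
    have s: "set p1 \<subseteq> fst G" "set p2 \<subseteq> fst G" "z \<in> fst G" and dQ: "Q \<inter> set p1 = {}" "Q \<inter> set p2 = {}" "z \<notin> Q"
      using V(2,4) unfolding sp by auto
    consider "touch G (set p1) Q" | "touch G (set p2) Q" | "\<not> touch G (set p1) Q" "\<not> touch G (set p2) Q"
      by blast
    then show ?thesis
    proof cases
      case 1
      \<comment> \<open>\<open>Q\<close> touches the first arc: \<open>x\<close>, this arc,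
        \<open>z\<close> with the other arc, and \<open>Q\<close> are pairwise touching.\<close>
      have "touch G {x} (set p1)" "touch G {x} (set (z # p2))" "touch G (set p1) (set (z # p2))"
        using e1 e2 mem by (auto intro: touchI)
      then have "induced_minor K4 G"
        using 1 x d s dQ V(1,3) ip ne touch_attached[OF xz(5), of "{x}"] touch_attached[OF xz(6), of "set (z # p2)"]
        by (intro K4_bags[OF G, of "{x}" "set p1" "set (z # p2)" Q] bag_singleton bag_ipath bagQ[OF xz(5)]) auto
      then show ?thesis ..
    next
      case 2
      have "touch G {x} (set (p1 @ [z]))" "touch G {x} (set p2)" "touch G (set (p1 @ [z])) (set p2)"
        using e1 e2 mem by (auto intro: touchI)
      then have "induced_minor K4 G"
        using 2 x d s dQ V(1,3) ip ne touch_attached[OF xz(5), of "{x}"] touch_attached[OF xz(6), of "set (p1 @ [z])"]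
        by (intro K4_bags[OF G, of "{x}" "set (p1 @ [z])" "set p2" Q] bag_singleton bag_ipath bagQ[OF xz(5)]) auto
      then show ?thesis ..
    next
      case 3
      \<comment> \<open>\<open>Q\<close> touches neither arc: \<open>x\<close> and \<open>z\<close>
        form one side, the two arcs and \<open>Q\<close> the other.\<close>
      have "touch G {x} (set p1)" "touch G {x} (set p2)" "touch G {z} (set p1)" "touch G {z} (set p2)"
        using e1 e2 mem adj_sym[OF e2(1)] by (auto intro: touchI)
      moreover have "\<not> touch G {x} {z}" using xz(4) by (simp add: touch_def)
      ultimately have "induced_minor K23 G"
        using 3 no x d s dQ V(1,3) ip ne touch_attached[OF xz(5), of "{x}"] touch_attached[OF xz(6), of "{z}"]
        by (intro K23_bags[OF G, of "{x}" "{z}" "set p1" "set p2" Q] bag_singleton bag_ipath bagQ[OF xz(5)]) auto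
      then show ?thesis ..
    qed
  qed
qed

section \<open>The excluded graphs contain bad pairs\<close>

lemma graph_iso_inverse:
  assumes "graph_iso G H f"
  shows "\<exists>g. bij_betw g (fst H) (fst G) \<and>
    (\<forall>i\<in>fst H. \<forall>j\<in>fst H. adj G (g i) (g j) \<longleftrightarrow> adj H i j)"
proof (intro exI conjI ballI)
  have f: "bij_betw f (fst G) (fst H)"
    "\<And>x y. x \<in> fst G \<Longrightarrow> y \<in> fst G \<Longrightarrow> adj G x y \<longleftrightarrow> adj H (f x) (f y)"
    using assms by (auto simp: graph_iso_def adj_def)
  let ?g = "the_inv_into (fst G) f"
  show "bij_betw ?g (fst H) (fst G)" using f(1) by (rule bij_betw_the_inv_into)
  show "adj G (?g i) (?g j) \<longleftrightarrow> adj H i j" if "i \<in> fst H" "j \<in> fst H" for i j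
  proof -
    have "?g k \<in> fst G" "f (?g k) = k" if "k \<in> fst H" for k
      using that f(1) bij_betw_the_inv_into[OF f(1)]
      by (auto simp: bij_betw_def f_the_inv_into_f)
    then show ?thesis using f(2)[of "?g i" "?g j"] that by simp
  qed
qed

lemma bad_K4:
  assumes "graph_iso G K4 f"
  shows "bad G"
proof -
  obtain g where g: "bij_betw g (fst K4) (fst G)"
    and a: "\<And>i j. i \<in> fst K4 \<Longrightarrow> j \<in> fst K4 \<Longrightarrow> adj G (g i) (g j) \<longleftrightarrow> adj K4 i j"
    using graph_iso_inverse[OF assms] by blast
  have V: "g i \<in> fst G" if "i \<in> fst K4" for i using g that by (auto simp: bij_betw_def)
  have inj: "g i = g j \<longleftrightarrow> i = j" if "i \<in> fst K4" "j \<in> fst K4" for i j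
    using g that by (auto simp: bij_betw_def inj_on_def)
  \<comment> \<open>A triangle with the fourth vertex attached to all of it.\<close>
  have "bad_pair G (g 0) [g 1, g 2] {g 3}"
    unfolding bad_pair_def icycle_def attached_def
    by (simp add: a V inj fst_K4 adj_K4)
  then show ?thesis unfolding bad_def by blast
qed

lemma bad_K23:
  assumes "graph_iso G K23 f"
  shows "bad G"
proof -
  obtain g where g: "bij_betw g (fst K23) (fst G)"
    and a: "\<And>i j. i \<in> fst K23 \<Longrightarrow> j \<in> fst K23 \<Longrightarrow> adj G (g i) (g j) \<longleftrightarrow> adj K23 i j"
    using graph_iso_inverse[OF assms] by blast
  have V: "g i \<in> fst G" if "i \<in> fst K23" for i using g that by (auto simp: bij_betw_def)
  have inj: "g i = g j \<longleftrightarrow> i = j" if "i \<in> fst K23" "j \<in> fst K23" for i j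
    using g that by (auto simp: bij_betw_def inj_on_def)
  \<comment> \<open>The 4-cycle through both vertices of the small side; the remaining vertex is
    attached to these two, which are nonadjacent.\<close>
  have "bad_pair G (g 0) [g 2, g 1, g 3] {g 4}"
    unfolding bad_pair_def icycle_def attached_def
    by (simp add: a V inj fst_K23 adj_K23)
  then show ?thesis unfolding bad_def by blast
qed

section \<open>Bad pairs lift along minor steps\<close>

lemma badI:
  assumes "icycle (adj G) y p" "insert y (set p) \<subseteq> fst G" "conn (adj G) Q" "Q \<subseteq> fst G"
    "Q \<inter> insert y (set p) = {}"
    and "(\<forall>x\<in>insert y (set p). attached G Q x) \<or>
     (\<exists>x\<in>insert y (set p). \<exists>z\<in>insert y (set p). x \<noteq> z \<and> \<not> adj G x z \<and> attached G Q x \<and> attached G Q z)"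
  shows "bad G"
  unfolding bad_def bad_pair_def by (intro exI conjI) (rule assms)+

lemma icycle_cong:
  assumes "\<And>a b. a \<in> insert y (set p) \<Longrightarrow> b \<in> insert y (set p) \<Longrightarrow> E a b \<longleftrightarrow> E' a b"
  shows "icycle E y p \<longleftrightarrow> icycle E' y p"
proof -
  have "ipath E p \<longleftrightarrow> ipath E' p" by (rule ipath_cong) (simp add: assms)
  then show ?thesis unfolding icycle_def by (simp add: assms cong: ball_cong)
qed

text \<open>Covers every minor operation that leaves the cycle intact, so that at most
  \<open>Q\<close> has to be adapted.\<close>

lemma bad_pair_transfer:
  assumes b: "bad_pair G' y p Q'" and sub: "fst G' \<subseteq> fst G"
    and cyc: "\<And>a b. a \<in> insert y (set p) \<Longrightarrow> b \<in> insert y (set p) \<Longrightarrow> adj G a b \<longleftrightarrow> adj G' a b"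
    and Q: "conn (adj G) Q" "Q \<subseteq> fst G" "Q \<inter> insert y (set p) = {}"
    and att: "\<And>x. x \<in> insert y (set p) \<Longrightarrow> attached G' Q' x \<Longrightarrow> attached G Q x"
  shows "bad G"
proof (rule badI[of _ y p Q])
  have "icycle (adj G') y p" "insert y (set p) \<subseteq> fst G'"
    and a: "(\<forall>x\<in>insert y (set p). attached G' Q' x) \<or>
      (\<exists>x\<in>insert y (set p). \<exists>z\<in>insert y (set p). x \<noteq> z \<and> \<not> adj G' x z \<and> attached G' Q' x \<and> attached G' Q' z)"
    using b by (simp_all only: bad_pair_def)
  then show "icycle (adj G) y p" "insert y (set p) \<subseteq> fst G"
    using icycle_cong[of y p "adj G" "adj G'"] cyc sub by simp_all blast
  from a show "(\<forall>x\<in>insert y (set p). attached G Q x) \<or>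
      (\<exists>x\<in>insert y (set p). \<exists>z\<in>insert y (set p). x \<noteq> z \<and> \<not> adj G x z \<and> attached G Q x \<and> attached G Q z)"
  proof
    assume "\<exists>x\<in>insert y (set p). \<exists>z\<in>insert y (set p). x \<noteq> z \<and> \<not> adj G' x z \<and> attached G' Q' x \<and> attached G' Q' z"
    then obtain x z where "x \<in> insert y (set p)" "z \<in> insert y (set p)" "x \<noteq> z" "\<not> adj G' x z"
      "attached G' Q' x" "attached G' Q' z" by blast
    then show ?thesis using cyc att by blast
  qed (use att in blast)
qed (fact Q)+

lemma bad_delete_vertex:
  assumes "bad (delete_vertex v G)"
  shows "bad G"
proof -
  obtain y p Q where b: "bad_pair (delete_vertex v G) y p Q" using assms unfolding bad_def by blast
  then have c: "conn (adj (delete_vertex v G)) Q" and s: "Q \<subseteq> fst G - {v}" "insert y (set p) \<subseteq> fst G - {v}"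
    and d: "Q \<inter> insert y (set p) = {}"
    unfolding bad_pair_def fst_delete_vertex by blast+
  have v: "v \<notin> Q" "v \<notin> insert y (set p)" using s by blast+
  have e: "adj (delete_vertex v G) a b \<longleftrightarrow> adj G a b" if "a \<noteq> v" "b \<noteq> v" for a b
    using that by (simp add: adj_delete_vertex)
  have "conn (adj (delete_vertex v G)) Q \<longleftrightarrow> conn (adj G) Q"
    by (rule conn_cong) (use e v in metis)
  with c have Q: "conn (adj G) Q" by blast
  show ?thesis
  proof (rule bad_pair_transfer[OF b _ _ Q])
    show "adj G a c \<longleftrightarrow> adj (delete_vertex v G) a c" if "a \<in> insert y (set p)" "c \<in> insert y (set p)" for a c
      using e v(2) that by metis
    show "attached G Q x" if "attached (delete_vertex v G) Q x" for x
      using that by (auto simp: attached_def adj_delete_vertex)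
  qed (use s d in auto)
qed

text \<open>A closed subset of \<open>insert v Q\<close> contains both or neither of
  \<open>u\<close> and \<open>v\<close>; removing \<open>v\<close> from it therefore leaves a closed
  subset in the contracted graph.\<close>

lemma conn_uncontract:
  assumes G: "simple_graph G" and uv: "adj G u v" and c: "conn (adj (contract_edge u v G)) Q" "u \<in> Q" "v \<notin> Q"
  shows "conn (adj G) (insert v Q)"
  unfolding conn_def
proof (intro allI impI)
  fix A assume A: "A \<subseteq> insert v Q" "A \<noteq> {}" "\<forall>a\<in>A. \<forall>b\<in>insert v Q. adj G a b \<longrightarrow> b \<in> A"
  have ne: "u \<noteq> v" using uv adj_irrefl[OF G] by blast
  have iff: "u \<in> A \<longleftrightarrow> v \<in> A" using A(3) uv adj_sym[OF uv] c(2) by blast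
  have m: "w \<in> A \<longleftrightarrow> merge u v w \<in> A" for w using iff by (simp add: merge_def)
  have "A - {v} = Q"
  proof (rule ccontr)
    assume neq: "A - {v} \<noteq> Q"
    have sub: "A - {v} \<subseteq> Q" using A(1) by blast
    have "A - {v} \<noteq> {}" using A(2) iff ne by blast
    from connD[OF c(1) sub this neq] obtain a b where ab: "a \<in> A - {v}" "b \<in> Q" "b \<notin> A - {v}"
      "adj (contract_edge u v G) a b" .
    then obtain a' b' where ab': "merge u v a' = a" "merge u v b' = b" "adj G a' b'"
      using adj_contract_edge[OF G ne] by blast
    have "a' \<in> A" using ab(1) ab'(1) m[of a'] by simp
    moreover have "b' \<in> insert v Q" using ab(2) ab'(2) by (auto simp: merge_def split: if_splits)
    ultimately have "b' \<in> A" using A(3) ab'(3) by blast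
    then have "b \<in> A" using m[of b'] ab'(2) by simp
    then show False using ab c(3) by blast
  qed
  then show "A = insert v Q" using iff c(2) ne by blast
qed

section \<open>Undoing a contraction on the cycle\<close>

text \<open>Here \<open>s\<close> and \<open>t\<close> are the ends of the contracted edge, in
  either order, and \<open>p\<close> is the rest of a cycle through the merged vertex;
  \<open>b\<close> expresses badness of that cycle in terms of \<open>G\<close>. As \<open>s\<close>
  sees both ends of \<open>p\<close>, it replaces the merged vertex.\<close>

lemma bad_lift_one:
  assumes G: "simple_graph G" and st: "adj G s t"
    and p: "length p \<ge> 2" "s \<notin> set p" "t \<notin> set p" "ipath (adj G) p" "set p \<subseteq> fst G"
    and nb: "\<And>w. w \<in> set p \<Longrightarrow> adj G s w \<or> adj G t w \<longleftrightarrow> w = hd p \<or> w = last p"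
    and Q: "conn (adj G) Q" "Q \<subseteq> fst G" "Q \<inter> insert s (insert t (set p)) = {}"
    and b: "(\<forall>w\<in>set p. attached G Q w) \<and> (attached G Q s \<or> attached G Q t) \<or>
      (\<exists>x\<in>set p. \<exists>z\<in>set p. x \<noteq> z \<and> \<not> adj G x z \<and> attached G Q x \<and> attached G Q z) \<or>
      (\<exists>z\<in>set p. \<not> adj G s z \<and> \<not> adj G t z \<and> attached G Q z \<and> (attached G Q s \<or> attached G Q t))"
    and hl: "adj G s (hd p)" "adj G s (last p)"
  shows "bad G"
proof -
  \<comment> \<open>Attachment of the merged vertex may come from \<open>t\<close> alone; moving
    \<open>t\<close> into the connected set passes it on to its neighbour \<open>s\<close>.\<close>
  define Q' where "Q' = (if attached G Q t then insert t Q else Q)"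
  have V: "s \<in> fst G" "t \<in> fst G" "s \<noteq> t" using st adj_in_verts[OF G] adj_irrefl[OF G] by blast+
  have c: "conn (adj G) Q'"
    using conn_insert[OF symp_adj Q(1), of _ t] Q(1) unfolding Q'_def attached_def by auto
  have att: "attached G Q' w" if "attached G Q w" for w
    using that unfolding Q'_def attached_def by auto
  have atts: "attached G Q' s" if "attached G Q s \<or> attached G Q t"
    using that st unfolding Q'_def attached_def by auto
  have cyc: "icycle (adj G) s p"
    unfolding icycle_def using p nb hl by blast
  show ?thesis
  proof (rule badI[OF cyc _ c])
    show "insert s (set p) \<subseteq> fst G" using p(5) V by simp
    show "Q' \<subseteq> fst G" using Q(2) V by (simp add: Q'_def)
    show "Q' \<inter> insert s (set p) = {}" using Q(3) V p(3) by (auto simp: Q'_def)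
    from b consider "(\<forall>w\<in>set p. attached G Q w)" "(attached G Q s \<or> attached G Q t)"
      | x z where "x \<in> set p" "z \<in> set p" "x \<noteq> z" "\<not> adj G x z" "attached G Q x" "attached G Q z"
      | z where "z \<in> set p" "\<not> adj G s z" "attached G Q z" "attached G Q s \<or> attached G Q t"
      by blast
    then show "(\<forall>x\<in>insert s (set p). attached G Q' x) \<or>
     (\<exists>x\<in>insert s (set p). \<exists>z\<in>insert s (set p). x \<noteq> z \<and> \<not> adj G x z \<and> attached G Q' x \<and> attached G Q' z)"
    proof cases
      case 1
      then show ?thesis using att atts by blast
    next
      case 2
      then show ?thesis using att by blast
    next
      case (3 z)
      then have "s \<noteq> z" using p(2) by blast
      then show ?thesis using att[OF 3(3)] atts[OF 3(4)] 3(1,2) by blast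
    qed
  qed
qed

text \<open>When \<open>s\<close> and \<open>t\<close> each see only one end of \<open>p\<close>,
  the cycle grows by one vertex and \<open>Q\<close> stays the same.\<close>

lemma bad_lift_both:
  assumes G: "simple_graph G" and st: "adj G s t"
    and p: "length p \<ge> 2" "s \<notin> set p" "t \<notin> set p" "ipath (adj G) p" "set p \<subseteq> fst G"
    and nb: "\<And>w. w \<in> set p \<Longrightarrow> adj G s w \<or> adj G t w \<longleftrightarrow> w = hd p \<or> w = last p"
    and Q: "conn (adj G) Q" "Q \<subseteq> fst G" "Q \<inter> insert s (insert t (set p)) = {}"
    and b: "(\<forall>w\<in>set p. attached G Q w) \<and> (attached G Q s \<or> attached G Q t) \<or>
      (\<exists>x\<in>set p. \<exists>z\<in>set p. x \<noteq> z \<and> \<not> adj G x z \<and> attached G Q x \<and> attached G Q z) \<or>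
      (\<exists>z\<in>set p. \<not> adj G s z \<and> \<not> adj G t z \<and> attached G Q z \<and> (attached G Q s \<or> attached G Q t))"
    and hl: "adj G s (hd p)" "adj G t (last p)" "\<not> adj G s (last p)" "\<not> adj G t (hd p)"
  shows "bad G"
proof -
  have V: "s \<in> fst G" "t \<in> fst G" "s \<noteq> t" using st adj_in_verts[OF G] adj_irrefl[OF G] by blast+
  have "p \<noteq> []" using p(1) by auto
  then have m: "hd p \<in> set p" "last p \<in> set p" by auto
  have "adj G x t \<longleftrightarrow> x = last p" if "x \<in> set p" for x
    using nb[OF that] hl adj_commute[of G x t] by blast
  then have ip: "ipath (adj G) (p @ [t])"
    unfolding ipath_append using p(3,4) by simp
  have "adj G s x \<longleftrightarrow> x = hd p" if "x \<in> set p" for x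
    using nb[OF that] hl by blast
  then have cyc: "icycle (adj G) s (p @ [t])"
    unfolding icycle_def using p ip V(3) st hl \<open>p \<noteq> []\<close> by auto
  show ?thesis
  proof (rule badI[OF cyc _ Q(1,2)])
    show "insert s (set (p @ [t])) \<subseteq> fst G" using p(5) V by simp
    show "Q \<inter> insert s (set (p @ [t])) = {}" using Q(3) by auto
    from b consider "attached G Q (hd p)" "attached G Q (last p)" "attached G Q s \<or> attached G Q t"
      | x z where "x \<in> set p" "z \<in> set p" "x \<noteq> z" "\<not> adj G x z" "attached G Q x" "attached G Q z"
      | z where "z \<in> set p" "\<not> adj G s z" "\<not> adj G t z" "attached G Q z" "attached G Q s \<or> attached G Q t"
      using m by blast
    then have "\<exists>x z. x \<in> insert s (set (p @ [t])) \<and> z \<in> insert s (set (p @ [t])) \<and> x \<noteq> z \<and> \<not> adj G x z \<and> attached G Q x \<and> attached G Q z"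
    proof cases
      case 1
      \<comment> \<open>The new cycle has at least four vertices, so full attachment is replaced by
        a nonadjacent pair: \<open>s\<close> with \<open>last p\<close>, or \<open>t\<close> with
        \<open>hd p\<close>.\<close>
      have "s \<noteq> last p" "t \<noteq> hd p" using p(2,3) m by metis+
      with 1 show ?thesis
        using m hl by (auto intro: exI[of _ s] exI[of _ t])
    next
      case 2
      then show ?thesis by auto
    next
      case (3 z)
      then have "s \<noteq> z" "t \<noteq> z" using p(2,3) by blast+
      with 3 show ?thesis by auto
    qed
    then show "(\<forall>x\<in>insert s (set (p @ [t])). attached G Q x) \<or>
     (\<exists>x\<in>insert s (set (p @ [t])). \<exists>z\<in>insert s (set (p @ [t])). x \<noteq> z \<and> \<not> adj G x z \<and> attached G Q x \<and> attached G Q z)"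
      by blast
  qed
qed

text \<open>If the merged vertex is off the cycle, the cycle survives and \<open>Q\<close> is
  expanded where necessary. If it is on the cycle, it becomes the base, and the cases record which
  of \<open>u\<close> and \<open>v\<close> sees which end of the path.\<close>

lemma bad_contract_edge:
  assumes G: "simple_graph G" and uv: "adj G u v" and "bad (contract_edge u v G)"
  shows "bad G"
proof -
  let ?G = "contract_edge u v G"
  obtain y p Q where b: "bad_pair ?G y p Q" using assms(3) unfolding bad_def by blast
  then have c: "icycle (adj ?G) y p" and s: "insert y (set p) \<subseteq> fst G - {v}"
    and Q: "conn (adj ?G) Q" "Q \<subseteq> fst G - {v}" "Q \<inter> insert y (set p) = {}"
    and a: "(\<forall>x\<in>insert y (set p). attached ?G Q x) \<or>
      (\<exists>x\<in>insert y (set p). \<exists>z\<in>insert y (set p). x \<noteq> z \<and> \<not> adj ?G x z \<and> attached ?G Q x \<and> attached ?G Q z)"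
    by (simp_all only: bad_pair_def fst_contract_edge)
  have ne: "u \<noteq> v" "u \<in> fst G" "v \<in> fst G" using uv adj_in_verts[OF G] adj_irrefl[OF G] by blast+
  have vv: "v \<notin> Q" "v \<notin> insert y (set p)" using s Q by blast+
  have ac: "adj ?G x w \<longleftrightarrow> x \<noteq> w \<and> (\<exists>a b. merge u v a = x \<and> merge u v b = w \<and> adj G a b)" for x w
    using adj_contract_edge[OF G ne(1)] .
  have mg: "merge u v a = w \<longleftrightarrow> a = w" if "w \<notin> {u, v}" for a w
    using that by (auto simp: merge_def)
  have mu: "merge u v a = u \<longleftrightarrow> a = u \<or> a = v" for a
    by (auto simp: merge_def)
  have e: "adj ?G x w \<longleftrightarrow> adj G x w" if "x \<notin> {u, v}" "w \<notin> {u, v}" for x w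
    unfolding ac mg[OF that(1)] mg[OF that(2)] using adj_irrefl[OF G, of x] by auto
  have eu: "adj ?G u w \<longleftrightarrow> adj G u w \<or> adj G v w" if "w \<notin> {u, v}" for w
    unfolding ac mu mg[OF that] using that by auto
  show ?thesis
  proof (cases "u \<in> insert y (set p)")
    case False
    \<comment> \<open>A merged vertex inside \<open>Q\<close> stands for both \<open>u\<close> and
      \<open>v\<close>; otherwise the contraction does not affect \<open>Q\<close>.\<close>
    define Q' where "Q' = (if u \<in> Q then insert v Q else Q)"
    have "adj ?G a d \<longleftrightarrow> adj G a d" if "u \<notin> Q" "a \<in> Q" "d \<in> Q" for a d
      using e[of a d] vv(1) that by blast
    then have "conn (adj ?G) Q \<longleftrightarrow> conn (adj G) Q" if "u \<notin> Q"
      using that conn_cong[of Q "adj ?G" "adj G"] by blast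
    then have cQ: "conn (adj G) Q'"
      using conn_uncontract[OF G uv Q(1) _ vv(1)] Q(1) by (simp add: Q'_def)
    show ?thesis
    proof (rule bad_pair_transfer[OF b _ _ cQ])
      show "adj G a d \<longleftrightarrow> adj ?G a d" if "a \<in> insert y (set p)" "d \<in> insert y (set p)" for a d
        using e[of a d] vv(2) False that by blast
      show "attached G Q' x" if h: "x \<in> insert y (set p)" "attached ?G Q x" for x
      proof -
        obtain q where q: "q \<in> Q" "adj ?G x q" using h(2) unfolding attached_def by blast
        have x: "x \<notin> {u, v}" using h(1) False vv(2) by blast
        show ?thesis
        proof (cases "q = u")
          case True
          then have "adj G u x \<or> adj G v x" using eu[OF x] adj_sym[OF q(2)] by simp
          then show ?thesis using q(1) True unfolding attached_def Q'_def by (auto dest: adj_sym)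
        next
          case False
          then have "adj G x q" using e[OF x, of q] q vv(1) by auto
          then show ?thesis using q(1) unfolding attached_def Q'_def by auto
        qed
      qed
    qed (use Q ne s vv in \<open>auto simp: Q'_def\<close>)
  next
    case True
    obtain p' where p': "icycle (adj ?G) u p'" "insert u (set p') = insert y (set p)"
      using icycle_rotate[OF symp_adj c True] .
    note s = s[folded p'(2)] and a = a[folded p'(2)] and vv = vv[folded p'(2)] and Qd = Q(3)[folded p'(2)]
    have p: "length p' \<ge> 2" "u \<notin> set p'" "ipath (adj ?G) p'"
        "\<And>z. z \<in> set p' \<Longrightarrow> adj ?G u z \<longleftrightarrow> z = hd p' \<or> z = last p'"
      using p'(1) unfolding icycle_def by blast+
    have n: "w \<notin> {u, v}" if "w \<in> Q \<or> w \<in> set p'" for w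
      using that vv Qd p(2) by blast
    have "ipath (adj ?G) p' \<longleftrightarrow> ipath (adj G) p'"
      by (rule ipath_cong) (use e n in blast)
    then have ip: "ipath (adj G) p'" using p(3) by blast
    have nb: "adj G u w \<or> adj G v w \<longleftrightarrow> w = hd p' \<or> w = last p'" if "w \<in> set p'" for w
      using p(4)[OF that] eu n that by blast
    have cQ: "conn (adj G) Q"
      using conn_cong[of Q "adj ?G" "adj G"] e n Q(1) by blast
    have at: "attached ?G Q w \<longleftrightarrow> attached G Q w" if "w \<in> set p'" for w
      unfolding attached_def using e n that by blast
    have atu: "attached ?G Q u \<longleftrightarrow> attached G Q u \<or> attached G Q v"
      unfolding attached_def using eu n by blast
    have sub: "set p' \<subseteq> fst G" "Q \<subseteq> fst G" and vp: "v \<notin> set p'"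
      and dis: "Q \<inter> insert u (insert v (set p')) = {}" "Q \<inter> insert v (insert u (set p')) = {}"
      using s vv Qd Q(2) by auto
    have bb: "(\<forall>w\<in>set p'. attached G Q w) \<and> (attached G Q u \<or> attached G Q v) \<or>
      (\<exists>x\<in>set p'. \<exists>z\<in>set p'. x \<noteq> z \<and> \<not> adj G x z \<and> attached G Q x \<and> attached G Q z) \<or>
      (\<exists>z\<in>set p'. \<not> adj G u z \<and> \<not> adj G v z \<and> attached G Q z \<and> (attached G Q u \<or> attached G Q v))"
      using a
    proof
      assume "\<forall>x\<in>insert u (set p'). attached ?G Q x"
      then show ?thesis using at atu by blast
    next
      assume "\<exists>x\<in>insert u (set p'). \<exists>z\<in>insert u (set p'). x \<noteq> z \<and> \<not> adj ?G x z \<and> attached ?G Q x \<and> attached ?G Q z"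
      then obtain x z where xz: "x \<in> insert u (set p')" "z \<in> insert u (set p')" "x \<noteq> z" "\<not> adj ?G x z"
        "attached ?G Q x" "attached ?G Q z" by blast
      have one: ?thesis if "z \<in> set p'" "\<not> adj ?G u z" "attached ?G Q z" "attached ?G Q u" for z
        using that at[OF that(1)] atu eu[of z] n by blast
      consider "x = u" "z \<in> set p'" | "z = u" "x \<in> set p'" | "x \<in> set p'" "z \<in> set p'"
        using xz(1-3) by blast
      then show ?thesis
      proof cases
        case 1
        then show ?thesis using one[of z] xz by simp
      next
        case 2
        then show ?thesis using one[of x] xz adj_commute[of ?G] by simp
      next
        case 3
        then have "\<not> adj G x z" using e[of x z] n xz(4) by blast
        then show ?thesis using 3 xz(3,5,6) at by blast
      qed
    qed
    \<comment> \<open>The versions with \<open>u\<close> and \<open>v\<close> exchanged feed the two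
      cases where \<open>v\<close> takes the role of \<open>s\<close>.\<close>
    have bb': "(\<forall>w\<in>set p'. attached G Q w) \<and> (attached G Q v \<or> attached G Q u) \<or>
      (\<exists>x\<in>set p'. \<exists>z\<in>set p'. x \<noteq> z \<and> \<not> adj G x z \<and> attached G Q x \<and> attached G Q z) \<or>
      (\<exists>z\<in>set p'. \<not> adj G v z \<and> \<not> adj G u z \<and> attached G Q z \<and> (attached G Q v \<or> attached G Q u))"
      using bb by blast
    have nb': "adj G v w \<or> adj G u w \<longleftrightarrow> w = hd p' \<or> w = last p'" if "w \<in> set p'" for w
      using nb[OF that] by blast
    have "p' \<noteq> []" using p(1) by auto
    then have "adj G u (hd p') \<or> adj G v (hd p')" "adj G u (last p') \<or> adj G v (last p')"
      using nb by auto
    then consider "adj G u (hd p')" "adj G u (last p')" | "adj G v (hd p')" "adj G v (last p')"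
      | "adj G u (hd p')" "adj G v (last p')" "\<not> adj G u (last p')" "\<not> adj G v (hd p')"
      | "adj G v (hd p')" "adj G u (last p')" "\<not> adj G v (last p')" "\<not> adj G u (hd p')"
      by blast
    then show ?thesis
    proof cases
      case 1
      show ?thesis by (rule bad_lift_one[OF G uv p(1,2) vp ip sub(1) nb cQ sub(2) dis(1) bb 1])
    next
      case 2
      show ?thesis by (rule bad_lift_one[OF G adj_sym[OF uv] p(1) vp p(2) ip sub(1) nb' cQ sub(2) dis(2) bb' 2])
    next
      case 3
      show ?thesis by (rule bad_lift_both[OF G uv p(1,2) vp ip sub(1) nb cQ sub(2) dis(1) bb 3])
    next
      case 4
      show ?thesis by (rule bad_lift_both[OF G adj_sym[OF uv] p(1) vp p(2) ip sub(1) nb' cQ sub(2) dis(2) bb' 4])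
    qed
  qed
qed

lemma bad_minor_steps:
  assumes "minor_step\<^sup>*\<^sup>* G G'" "simple_graph G"
  shows "simple_graph G' \<and> (bad G' \<longrightarrow> bad G)"
  using assms
proof (induction rule: rtranclp_induct)
  case (step G' G'')
  have G': "simple_graph G'" "bad G' \<longrightarrow> bad G" using step.IH[OF step.prems] by simp_all
  have "bad G'" if bad: "bad G''"
    using step(2)
  proof cases
    case (del v)
    show ?thesis using bad unfolding del(1) by (rule bad_delete_vertex)
  next
    case (con u v)
    show ?thesis using bad unfolding con(1)
      by (rule bad_contract_edge[OF G'(1), rotated]) (use con(2) in \<open>simp add: adj_def\<close>)
  qed
  then show ?case using G' simple_graph_minor_step[OF step(2)] by blast
qed simp

lemma induced_minor_bad:
  assumes "simple_graph G" "induced_minor K4 G \<or> induced_minor K23 G"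
  shows "bad G"
proof -
  obtain G' where G': "minor_step\<^sup>*\<^sup>* G G'" "(\<exists>f. graph_iso G' K4 f) \<or> (\<exists>f. graph_iso G' K23 f)"
    using assms(2) unfolding induced_minor_def by blast
  then have "simple_graph G'" "bad G' \<Longrightarrow> bad G" using bad_minor_steps assms(1) by blast+
  then show ?thesis using G'(2) bad_K4 bad_K23 by blast
qed

section \<open>Orienting graphs without bad pairs\<close>

lemma cyclic_orientation_iff:
  "cyclic_orientation G D \<longleftrightarrow> simple_graph G \<and> is_orientation G D \<and>
     (\<forall>cs. chordless_cycle G cs \<longrightarrow> cyclically_oriented D cs)"
  unfolding cyclic_orientation_def by blast

lemma cyclically_orientable_iff:
  "simple_graph G \<Longrightarrow> cyclically_orientable G \<longleftrightarrow> (\<exists>D. cyclic_orientation G D)"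
  unfolding cyclically_orientable_def cyclic_orientation_iff by blast

lemma is_orientation_iff:
  "is_orientation G D \<longleftrightarrow> (\<forall>x y. (x, y) \<in> D \<longrightarrow> adj G x y) \<and>
     (\<forall>x y. adj G x y \<longrightarrow> ((x, y) \<in> D \<longleftrightarrow> (y, x) \<notin> D))"
  unfolding is_orientation_def adj_def by blast

lemma cyclically_oriented_mono: "cyclically_oriented D cs \<Longrightarrow> D \<subseteq> D' \<Longrightarrow> cyclically_oriented D' cs"
  unfolding cyclically_oriented_def by blast

text \<open>Permits reversing one side of a separation to match the other on a shared edge.\<close>

lemma cyclic_orientation_converse:
  assumes "cyclic_orientation G D"
  shows "cyclic_orientation G (D\<inverse>)"
proof -
  have "cyclically_oriented (D\<inverse>) cs" if "cyclically_oriented D cs" for cs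
    using that unfolding cyclically_oriented_def converse_iff by blast
  moreover have "is_orientation G (D\<inverse>)"
    using assms unfolding cyclic_orientation_iff is_orientation_iff converse_iff using adj_sym by metis
  ultimately show ?thesis using assms unfolding cyclic_orientation_iff by blast
qed

section \<open>Induced subgraphs\<close>

definition induced_subgraph :: "'a set \<Rightarrow> 'a graph \<Rightarrow> 'a graph" where
  "induced_subgraph W G = (W, {e \<in> snd G. e \<subseteq> W})"

lemma fst_induced_subgraph [simp]: "fst (induced_subgraph W G) = W"
  by (simp add: induced_subgraph_def)

lemma adj_induced_subgraph: "adj (induced_subgraph W G) x y \<longleftrightarrow> adj G x y \<and> x \<in> W \<and> y \<in> W"
  by (auto simp: adj_def induced_subgraph_def)

lemma simple_graph_induced_subgraph:
  "simple_graph G \<Longrightarrow> W \<subseteq> fst G \<Longrightarrow> simple_graph (induced_subgraph W G)"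
  by (auto simp: simple_graph_def induced_subgraph_def intro: finite_subset)

lemma chordless_cycle_induced_subgraph:
  assumes "chordless_cycle G cs" "set cs \<subseteq> W"
  shows "chordless_cycle (induced_subgraph W G) cs"
proof -
  have "cs ! i \<in> W" if "i < length cs" for i using assms(2) that by auto
  then show ?thesis
    using assms unfolding chordless_cycle_def adj_def[symmetric] adj_induced_subgraph fst_induced_subgraph by simp
qed

lemma bad_induced_subgraph:
  assumes "bad (induced_subgraph W G)" "W \<subseteq> fst G"
  shows "bad G"
proof -
  let ?G = "induced_subgraph W G"
  obtain y p Q where b: "bad_pair ?G y p Q" using assms unfolding bad_def by blast
  then have c: "conn (adj ?G) Q" and s: "Q \<subseteq> W" "insert y (set p) \<subseteq> W"
    and d: "Q \<inter> insert y (set p) = {}"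
    unfolding bad_pair_def fst_induced_subgraph by blast+
  have e: "adj ?G a b \<longleftrightarrow> adj G a b" if "a \<in> W" "b \<in> W" for a b
    unfolding adj_induced_subgraph using that by blast
  have "adj ?G a b \<longleftrightarrow> adj G a b" if "a \<in> Q" "b \<in> Q" for a b
    using e subsetD[OF s(1)] that by metis
  then have Q: "conn (adj G) Q"
    using c conn_cong[of Q "adj ?G" "adj G"] by blast
  show ?thesis
  proof (rule bad_pair_transfer[OF b _ _ Q])
    show "adj G a c \<longleftrightarrow> adj ?G a c" if "a \<in> insert y (set p)" "c \<in> insert y (set p)" for a c
      using e[of a c] s(2) that by blast
    show "attached G Q x" if "attached ?G Q x" for x
      using that unfolding attached_def adj_induced_subgraph by blast
  qed (use s d assms(2) in auto)
qed

lemma exists_orientation: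
  assumes "simple_graph G"
  shows "\<exists>D. is_orientation G D"
proof -
  \<comment> \<open>The chosen endpoint depends only on the edge as a set, so both orders of its
    ends agree on the tail.\<close>
  define s :: "'a set \<Rightarrow> 'a" where "s e = (SOME z. z \<in> e)" for e
  define D where "D = {(x, y). adj G x y \<and> x = s {x, y}}"
  have "(x, y) \<in> D \<longleftrightarrow> (y, x) \<notin> D" if h: "adj G x y" for x y
  proof -
    have "x \<noteq> y" using h adj_irrefl[OF assms] by blast
    moreover have "s {x, y} \<in> {x, y}" unfolding s_def by (rule someI[of _ x]) simp
    moreover have "s {y, x} = s {x, y}" by (simp only: insert_commute)
    ultimately show ?thesis using h adj_sym[OF h] unfolding D_def mem_Collect_eq case_prod_conv by auto
  qed
  moreover have "adj G x y" if "(x, y) \<in> D" for x y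
    using that by (simp add: D_def)
  ultimately have "is_orientation G D" unfolding is_orientation_iff by blast
  then show ?thesis ..
qed

section \<open>Clique separations and gluing\<close>

text \<open>\<open>S - B\<close> is nonempty and proper in \<open>S\<close>, so an edge leaves it;
  its endpoint in \<open>B\<close> must also lie in \<open>A\<close>, as no edge joins
  \<open>A - B\<close> to \<open>B - A\<close>.\<close>

lemma separation_meets:
  assumes "conn E S" "S \<subseteq> A \<union> B" "x \<in> S" "x \<notin> B" "z \<in> S" "z \<notin> A"
    and sep: "\<And>a b. E a b \<Longrightarrow> a \<in> A - B \<Longrightarrow> b \<in> B - A \<Longrightarrow> False"
  obtains k where "k \<in> S" "k \<in> A" "k \<in> B"
proof -
  have "S - B \<subseteq> S" "S - B \<noteq> {}" "S - B \<noteq> S" using assms by blast+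
  from connD[OF assms(1) this] obtain a b where "a \<in> S - B" "b \<in> S" "b \<notin> S - B" "E a b" .
  then show ?thesis using sep[of a b] that[of b] assms(2) by blast
qed

text \<open>If \<open>x\<close> lies outside \<open>B\<close> and \<open>z\<close> outside
  \<open>A\<close>, both arcs between them have an interior vertex in \<open>A \<inter> B\<close>.
  These two vertices are adjacent in the clique, giving a chord.\<close>

lemma icycle_clique_separation:
  assumes sym: "symp E" and c: "icycle E y p" and V: "insert y (set p) \<subseteq> A \<union> B"
    and sep: "\<And>a b. E a b \<Longrightarrow> a \<in> A - B \<Longrightarrow> b \<in> B - A \<Longrightarrow> False"
    and clique: "\<And>a b. a \<in> A \<inter> B \<Longrightarrow> b \<in> A \<inter> B \<Longrightarrow> a \<noteq> b \<Longrightarrow> E a b"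
  shows "insert y (set p) \<subseteq> A \<or> insert y (set p) \<subseteq> B"
proof (rule ccontr)
  assume "\<not> ?thesis"
  then obtain x z where xz: "x \<in> insert y (set p)" "x \<notin> B" "z \<in> insert y (set p)" "z \<notin> A" by blast
  obtain p' where p': "icycle E x p'" "insert x (set p') = insert y (set p)"
    using icycle_rotate[OF sym c xz(1)] .
  have xA: "x \<in> A" using xz V by blast
  have "z \<in> insert x (set p')" unfolding p'(2) by (fact xz(3))
  then have zp: "z \<in> set p'" using xz(4) xA by auto
  have zB: "z \<in> B" using xz V by blast
  have p: "length p' \<ge> 2" "ipath E p'" "x \<notin> set p'"
       "\<And>w. w \<in> set p' \<Longrightarrow> E x w \<longleftrightarrow> w = hd p' \<or> w = last p'"
    using p'(1) unfolding icycle_def by blast+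
  obtain p1 p2 where sp: "p' = p1 @ z # p2" using zp by (meson split_list)
  have nxz: "\<not> E x z" using sep[of x z] xz xA zB by blast
  have ne: "p1 \<noteq> []" "p2 \<noteq> []" using p(4)[OF zp] nxz unfolding sp by auto
  have ip: "ipath E (z # p2)" "ipath E (p1 @ [z])"
    and no: "\<And>a b. a \<in> set p1 \<Longrightarrow> b \<in> set p2 \<Longrightarrow> a \<noteq> b \<and> \<not> E a b"
    using p(2) unfolding sp ipath_append by auto
  have sub: "set p1 \<subseteq> A \<union> B" "set p2 \<subseteq> A \<union> B" using V unfolding p'(2)[symmetric] sp by auto
  have "E x (hd p1)" "E x (last p2)" using p(4) ne unfolding sp by auto
  then have c1: "conn E (insert x (set (p1 @ [z])))" and c2: "conn E (insert x (set (z # p2)))"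
    using conn_insert[OF sym ipath_conn[OF sym ip(2)], of "hd p1" x]
      conn_insert[OF sym ipath_conn[OF sym ip(1)], of "last p2" x] ne by simp_all
  have S: "insert x (set (p1 @ [z])) \<subseteq> A \<union> B" "insert x (set (z # p2)) \<subseteq> A \<union> B"
    using sub xA zB by auto
  have zS: "z \<in> insert x (set (p1 @ [z]))" "z \<in> insert x (set (z # p2))" by simp_all
  obtain k1 where "k1 \<in> insert x (set (p1 @ [z]))" "k1 \<in> A" "k1 \<in> B"
    by (rule separation_meets[OF c1 S(1) insertI1 xz(2) zS(1) xz(4) sep])
  moreover obtain k2 where "k2 \<in> insert x (set (z # p2))" "k2 \<in> A" "k2 \<in> B"
    by (rule separation_meets[OF c2 S(2) insertI1 xz(2) zS(2) xz(4) sep])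
  ultimately have "k1 \<in> set p1" "k2 \<in> set p2" "k1 \<in> A \<inter> B" "k2 \<in> A \<inter> B" using xz by auto
  then show False using no clique by blast
qed

text \<open>The two sides share at most one edge, so reversing one orientation if necessary makes
  them agree there. Their union is then cyclic, because every chordless cycle lies in one
  side.\<close>

lemma glue_orientations:
  assumes G: "simple_graph G" and AB: "A \<union> B = fst G"
    and sep: "\<And>a b. adj G a b \<Longrightarrow> a \<in> A - B \<Longrightarrow> b \<in> B - A \<Longrightarrow> False"
    and clique: "\<And>a b. a \<in> A \<inter> B \<Longrightarrow> b \<in> A \<inter> B \<Longrightarrow> a \<noteq> b \<Longrightarrow> adj G a b"
    and K: "A \<inter> B \<subseteq> {k, l}"
    and D1: "cyclic_orientation (induced_subgraph A G) D1"
    and D2: "cyclic_orientation (induced_subgraph B G) D2"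
  shows "cyclically_orientable G"
proof -
  obtain D3 where D3: "cyclic_orientation (induced_subgraph B G) D3"
    and agree1: "k \<in> A \<inter> B \<Longrightarrow> l \<in> A \<inter> B \<Longrightarrow> adj G k l \<Longrightarrow> (k, l) \<in> D1 \<longleftrightarrow> (k, l) \<in> D3"
  proof (cases "k \<in> A \<inter> B \<and> l \<in> A \<inter> B \<and> adj G k l \<and> ((k, l) \<in> D1 \<longleftrightarrow> (k, l) \<notin> D2)")
    case True
    then have "(k, l) \<in> D2\<inverse> \<longleftrightarrow> (k, l) \<notin> D2"
      using D2 adj_sym[of G k l] unfolding cyclic_orientation_iff is_orientation_iff adj_induced_subgraph converse_iff by blast
    then show ?thesis using that[OF cyclic_orientation_converse[OF D2]] True by blast
  next
    case False
    then show ?thesis using that[OF D2] by blast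
  qed
  have o1: "(x, y) \<in> D1 \<Longrightarrow> adj G x y \<and> x \<in> A \<and> y \<in> A"
      "adj G x y \<Longrightarrow> x \<in> A \<Longrightarrow> y \<in> A \<Longrightarrow> (x, y) \<in> D1 \<longleftrightarrow> (y, x) \<notin> D1" for x y
    using D1 unfolding cyclic_orientation_iff is_orientation_iff adj_induced_subgraph by blast+
  have o3: "(x, y) \<in> D3 \<Longrightarrow> adj G x y \<and> x \<in> B \<and> y \<in> B"
      "adj G x y \<Longrightarrow> x \<in> B \<Longrightarrow> y \<in> B \<Longrightarrow> (x, y) \<in> D3 \<longleftrightarrow> (y, x) \<notin> D3" for x y
    using D3 unfolding cyclic_orientation_iff is_orientation_iff adj_induced_subgraph by blast+
  have agree: "(x, y) \<in> D1 \<longleftrightarrow> (x, y) \<in> D3" if h: "x \<in> A \<inter> B" "y \<in> A \<inter> B" "adj G x y" for x y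
  proof -
    have "x \<noteq> y" using h(3) adj_irrefl[OF G] by blast
    then consider "x = k" "y = l" | "x = l" "y = k" using h(1,2) K by blast
    then show ?thesis
    proof cases
      case 1
      then show ?thesis using agree1 h by simp
    next
      case 2
      then have "(k, l) \<in> D1 \<longleftrightarrow> (k, l) \<in> D3" using agree1 h adj_sym[OF h(3)] by simp
      then show ?thesis using o1(2)[of x y] o3(2)[of x y] h 2 by simp
    qed
  qed
  \<comment> \<open>By agreement on the overlap, the union restricts to the given orientation on
    each side.\<close>
  have DA: "(x, y) \<in> D1 \<union> D3 \<longleftrightarrow> (x, y) \<in> D1" if "x \<in> A" "y \<in> A" for x y
    using agree[of x y] o3(1)[of x y] that by blast
  have DB: "(x, y) \<in> D1 \<union> D3 \<longleftrightarrow> (x, y) \<in> D3" if "x \<in> B" "y \<in> B" for x y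
    using agree[of x y] o1(1)[of x y] that by blast
  have "(x, y) \<in> D1 \<union> D3 \<longleftrightarrow> (y, x) \<notin> D1 \<union> D3" if h: "adj G x y" for x y
  proof -
    have "x \<in> A \<union> B" "y \<in> A \<union> B" using adj_in_verts[OF G h] AB by blast+
    then consider "x \<in> A" "y \<in> A" | "x \<in> B" "y \<in> B"
      using sep[of x y] sep[of y x] h adj_sym[OF h] by blast
    then show ?thesis
    proof cases
      case 1
      then show ?thesis using DA[of x y] DA[of y x] o1(2)[OF h] by blast
    next
      case 2
      then show ?thesis using DB[of x y] DB[of y x] o3(2)[OF h] by blast
    qed
  qed
  then have "is_orientation G (D1 \<union> D3)"
    unfolding is_orientation_iff using o1(1) o3(1) by blast
  moreover have "cyclically_oriented (D1 \<union> D3) cs" if c: "chordless_cycle G cs" for cs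
  proof -
    obtain y p where cs: "cs = y # p" using c by (cases cs) (auto simp: chordless_cycle_def)
    have "icycle (adj G) y p" "insert y (set p) \<subseteq> A \<union> B"
      using c unfolding cs chordless_cycle_iff[OF G] AB by blast+
    then have "set cs \<subseteq> A \<or> set cs \<subseteq> B"
      using icycle_clique_separation[OF symp_adj _ _ sep clique] unfolding cs by simp
    then show ?thesis
    proof
      assume "set cs \<subseteq> A"
      then have "cyclically_oriented D1 cs"
        using D1 chordless_cycle_induced_subgraph[OF c] unfolding cyclic_orientation_iff by blast
      then show ?thesis by (rule cyclically_oriented_mono) blast
    next
      assume "set cs \<subseteq> B"
      then have "cyclically_oriented D3 cs"
        using D3 chordless_cycle_induced_subgraph[OF c] unfolding cyclic_orientation_iff by blast
      then show ?thesis by (rule cyclically_oriented_mono) blast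
    qed
  qed
  ultimately show ?thesis unfolding cyclically_orientable_def by blast
qed

section \<open>Graphs spanned by a chordless cycle\<close>

lemma Suc_mod_inject: "i < n \<Longrightarrow> j < n \<Longrightarrow> Suc i mod n = Suc j mod n \<longleftrightarrow> i = j" for n :: nat
  by (auto simp: Suc_mod_less simp del: mod_Suc split: if_splits)

lemma cyclic_induct:
  fixes n :: nat
  assumes "i < n" "P i" and step: "\<And>j. j < n \<Longrightarrow> P j \<Longrightarrow> P (Suc j mod n)" and "k < n"
  shows "P k"
proof -
  have "P ((i + m) mod n)" for m
  proof (induction m)
    case 0
    then show ?case using assms(1,2) by simp
  next
    case (Suc m)
    have "(i + m) mod n < n" using assms(1) by simp
    from step[OF this Suc] show ?case by (simp add: mod_Suc_eq)
  qed
  \<comment> \<open>Going \<open>k + n - i\<close> steps from \<open>i\<close> ends at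
    \<open>k\<close> modulo \<open>n\<close>; the summand \<open>n\<close> avoids truncated
    subtraction.\<close>
  from this[of "k + n - i"] show ?thesis using assms(1,4) by simp
qed

text \<open>Orient all edges along \<open>cs\<close>, so that every vertex has at most one incoming
  edge. A direction change on a chordless cycle \<open>ds\<close> would create two, so there is no
  need to show that \<open>ds\<close> is a rotation or reflection of \<open>cs\<close>.\<close>

lemma spanning_chordless_cycle:
  assumes G: "simple_graph G" and c: "chordless_cycle G cs" and span: "set cs = fst G"
  shows "cyclically_orientable G"
proof -
  define n where "n = length cs"
  have n: "n \<ge> 3" "distinct cs"
    and a: "\<And>i j. i < n \<Longrightarrow> j < n \<Longrightarrow> adj G (cs ! i) (cs ! j) \<longleftrightarrow> j = Suc i mod n \<or> i = Suc j mod n"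
    using c unfolding chordless_cycle_def n_def adj_def by blast+
  define D where "D = {(cs ! i, cs ! (Suc i mod n)) | i. i < n}"
  have m: "Suc i mod n < n" for i using n(1) by simp
  have inj: "cs ! i = cs ! j \<longleftrightarrow> i = j" if "i < n" "j < n" for i j
    using nth_eq_iff_index_eq[OF n(2)] that n_def by blast
  have D: "(cs ! i, cs ! j) \<in> D \<longleftrightarrow> j = Suc i mod n" if "i < n" "j < n" for i j
    using that inj m unfolding D_def by auto
  have in_unique: "x = y" if xy: "(x, z) \<in> D" "(y, z) \<in> D" for x y z
  proof -
    obtain i j where "i < n" "j < n" "x = cs ! i" "y = cs ! j" "cs ! (Suc i mod n) = cs ! (Suc j mod n)"
      using xy unfolding D_def by auto
    then show ?thesis using inj[OF m m] Suc_mod_inject by blast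
  qed
  have D_adj: "adj G x y" if "(x, y) \<in> D" for x y
    using that a m unfolding D_def by auto
  have "(x, y) \<in> D \<longleftrightarrow> (y, x) \<notin> D" if h: "adj G x y" for x y
  proof -
    obtain i j where ij: "i < n" "j < n" "x = cs ! i" "y = cs ! j"
      using adj_in_verts[OF G h] unfolding span[symmetric] in_set_conv_nth n_def by blast
    have "j = Suc i mod n \<or> i = Suc j mod n" using h a ij by blast
    \<comment> \<open>With \<open>n \<ge> 3\<close>, two positions cannot each follow the
      other.\<close>
    moreover have "\<not> (j = Suc i mod n \<and> i = Suc j mod n)"
      using n(1) ij(1,2) by (auto simp: Suc_mod_less simp del: mod_Suc split: if_splits)
    ultimately show ?thesis using D ij by blast
  qed
  then have o: "is_orientation G D" unfolding is_orientation_iff using D_adj by blast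
  have "cyclically_oriented D ds" if d: "chordless_cycle G ds" for ds
  proof -
    define k where "k = length ds"
    have k: "k \<ge> 3" "distinct ds"
      and ad: "\<And>i j. i < k \<Longrightarrow> j < k \<Longrightarrow> adj G (ds ! i) (ds ! j) \<longleftrightarrow> j = Suc i mod k \<or> i = Suc j mod k"
      using d unfolding chordless_cycle_def k_def adj_def by blast+
    have mk: "Suc i mod k < k" for i using k(1) by simp
    have as: "adj G (ds ! i) (ds ! (Suc i mod k))" if "i < k" for i
      using ad that mk by blast
    have step: "(ds ! (Suc i mod k), ds ! (Suc (Suc i mod k) mod k)) \<in> D"
      if h: "i < k" "(ds ! i, ds ! (Suc i mod k)) \<in> D" for i
    proof (rule ccontr)
      assume "\<not> ?thesis"
      then have "(ds ! (Suc (Suc i mod k) mod k), ds ! (Suc i mod k)) \<in> D"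
        using adj_orientation[OF o as[OF mk]] by blast
      then have "ds ! i = ds ! (Suc (Suc i mod k) mod k)" using in_unique h(2) by blast
      \<comment> \<open>Going two steps around a cycle of length at least 3 never returns to the
        start.\<close>
      then have "i = Suc (Suc i mod k) mod k"
        using nth_eq_iff_index_eq[OF k(2)] h(1) mk unfolding k_def by blast
      then show False
        using h(1) k(1) mk[of i] by (auto simp: Suc_mod_less simp del: mod_Suc split: if_splits)
    qed
    show ?thesis
    proof (cases "\<exists>i<k. (ds ! i, ds ! (Suc i mod k)) \<in> D")
      case True
      then obtain i where "i < k" "(ds ! i, ds ! (Suc i mod k)) \<in> D" by blast
      then have "(ds ! j, ds ! (Suc j mod k)) \<in> D" if "j < k" for j
        using cyclic_induct[where P = "\<lambda>i. (ds ! i, ds ! (Suc i mod k)) \<in> D", OF _ _ step that] by blast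
      then show ?thesis unfolding cyclically_oriented_def k_def by blast
    next
      case False
      then have "(ds ! (Suc j mod k), ds ! j) \<in> D" if "j < k" for j
        using adj_orientation[OF o as[OF that]] that by blast
      then show ?thesis unfolding cyclically_oriented_def k_def by blast
    qed
  qed
  then show ?thesis using o unfolding cyclically_orientable_def by blast
qed

text \<open>With \<open>a\<close> as base, its neighbours \<open>b\<close> and \<open>d\<close> are
  the two ends of an induced path; since they are adjacent, the path has only these two
  vertices.\<close>

lemma icycle_triangle:
  assumes sym: "symp E" and c: "icycle E y p" and C: "{a, b, d} \<subseteq> insert y (set p)" "a \<noteq> b" "b \<noteq> d" "a \<noteq> d"
    and E: "E a b" "E b d" "E a d"
  shows "insert y (set p) = {a, b, d}"
proof -
  obtain p' where p': "icycle E a p'" "insert a (set p') = insert y (set p)"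
    using icycle_rotate[OF sym c, of a] C(1) by blast
  have p: "length p' \<ge> 2" "ipath E p'" "a \<notin> set p'"
       "\<And>w. w \<in> set p' \<Longrightarrow> E a w \<longleftrightarrow> w = hd p' \<or> w = last p'"
    using p'(1) unfolding icycle_def by blast+
  have bd: "b \<in> set p'" "d \<in> set p'" using C(1) C(2-4) unfolding p'(2)[symmetric] by auto
  then have hl: "b = hd p' \<and> d = last p' \<or> d = hd p' \<and> b = last p'"
    using p(4) E C(3) by blast
  then have e: "E (hd p') (last p')" using E(2) sympD[OF sym] by blast
  obtain s t q where st: "p' = s # t # q" using p(1) by (cases p'; cases "tl p'") auto
  have "E s (last (t # q))" using e unfolding st by simp
  moreover have "last (t # q) \<in> set (t # q)" by simp
  moreover have "\<forall>z\<in>set (t # q). E s z \<longleftrightarrow> z = t" using p(2) unfolding st by simp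
  ultimately have "last (t # q) = t" by blast
  moreover have "t \<notin> set q" using p(2) unfolding st by simp
  ultimately have "q = []" by (cases q rule: rev_cases) auto
  then have "set p' = {b, d}" using hl unfolding st by auto
  then show ?thesis using p'(2) by simp
qed

section \<open>Induction over clique separations\<close>

lemma not_bad_cyclically_orientable:
  assumes "simple_graph G" "\<not> bad G"
  shows "cyclically_orientable G"
  using assms
proof (induction "card (fst G)" arbitrary: G rule: less_induct)
  case less
  note G = less.prems(1)
  have fin: "finite (fst G)" using G by (simp add: simple_graph_def)
  show ?case
  proof (cases "\<exists>cs. chordless_cycle G cs")
    case False
    then show ?thesis using exists_orientation[OF G] unfolding cyclically_orientable_def by blast
  next
    case True
    then obtain cs where cs: "chordless_cycle G cs" by blast
    obtain y p where yp: "cs = y # p" using cs by (cases cs) (auto simp: chordless_cycle_def)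
    define C where "C = insert y (set p)"
    have c: "icycle (adj G) y p" and CV: "C \<subseteq> fst G"
      using cs unfolding yp chordless_cycle_iff[OF G] C_def by blast+
    have setcs: "set cs = C" by (simp add: yp C_def)
    show ?thesis
    proof (cases "C = fst G")
      case True
      then show ?thesis using spanning_chordless_cycle[OF G cs] setcs by simp
    next
      case False
      then obtain q where q: "q \<in> fst G - C" using CV by blast
      obtain Q where Q: "conn (adj G) Q" "q \<in> Q" "Q \<subseteq> fst G - C"
        and mx: "\<And>a b. a \<in> Q \<Longrightarrow> b \<in> fst G - C \<Longrightarrow> adj G a b \<Longrightarrow> b \<in> Q"
        using component_exists[OF symp_adj finite_Diff[OF fin] q, of G] by blast
      \<comment> \<open>\<open>K\<close> collects the attachments of the component \<open>Q\<close>
        on the cycle; without bad pairs it is a clique and a proper subset of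
        \<open>C\<close>.\<close>
      define K where "K = {x \<in> C. attached G Q x}"
      have "\<not> bad_pair G y p Q" using less.prems(2) unfolding bad_def by blast
      then have nb: "\<not> (\<forall>x\<in>C. attached G Q x)"
        "\<not> (\<exists>x\<in>C. \<exists>z\<in>C. x \<noteq> z \<and> \<not> adj G x z \<and> attached G Q x \<and> attached G Q z)"
        using c CV Q(1,3) unfolding bad_pair_def C_def[symmetric] by blast+
      have KC: "K \<subset> C" using nb(1) unfolding K_def by blast
      have clique: "adj G a b" if "a \<in> K" "b \<in> K" "a \<noteq> b" for a b
        using nb(2) that unfolding K_def by blast
      \<comment> \<open>No edges leave \<open>Q\<close> except to \<open>K\<close>, so
        \<open>K\<close> separates \<open>Q\<close> from the rest.\<close>
      define A B where "A = Q \<union> K" and "B = fst G - Q"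
      have AB: "A \<union> B = fst G" "A \<inter> B = K" "A \<subseteq> fst G" "B \<subseteq> fst G"
        using Q(3) KC CV unfolding A_def B_def by blast+
      have sep: False if h: "adj G a b" "a \<in> A - B" "b \<in> B - A" for a b
      proof -
        have ab: "a \<in> Q" "b \<in> fst G" "b \<notin> Q" "b \<notin> K" using h AB CV KC Q(3) unfolding A_def B_def by blast+
        then have "b \<in> C" using mx h(1) by blast
        then show False using ab adj_sym[OF h(1)] unfolding K_def attached_def by blast
      qed
      \<comment> \<open>Three vertices of the clique \<open>K\<close> would form a triangle on
        \<open>C\<close> and hence be all of \<open>C\<close>, while \<open>K\<close> is
        proper.\<close>
      have "\<exists>k l. K \<subseteq> {k, l}"
      proof (rule ccontr)
        assume n: "\<nexists>k l. K \<subseteq> {k, l}"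
        then obtain a where a: "a \<in> K" by blast
        from n obtain b where b: "b \<in> K" "b \<noteq> a" by blast
        from n obtain d where d: "d \<in> K" "d \<noteq> a" "d \<noteq> b" by blast
        have "C = {a, b, d}"
          using icycle_triangle[OF symp_adj c, of a b d] a b d clique KC unfolding C_def[symmetric] by blast
        then show False using KC a b d by blast
      qed
      then obtain k l where kl: "A \<inter> B \<subseteq> {k, l}" unfolding AB(2) by blast
      have sub: "\<exists>D. cyclic_orientation (induced_subgraph W G) D" if h: "W \<subset> fst G" for W
      proof -
        have W: "W \<subseteq> fst G" using h by blast
        have "card (fst (induced_subgraph W G)) < card (fst G)"
          using psubset_card_mono[OF fin h] by simp
        moreover have s: "simple_graph (induced_subgraph W G)" using simple_graph_induced_subgraph[OF G W] .
        moreover have "\<not> bad (induced_subgraph W G)" using less.prems(2) bad_induced_subgraph[OF _ W] by blast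
        ultimately have "cyclically_orientable (induced_subgraph W G)" by (rule less.hyps)
        then show ?thesis unfolding cyclically_orientable_iff[OF s] .
      qed
      \<comment> \<open>\<open>A\<close> misses a vertex of \<open>C\<close> outside
        \<open>K\<close>, and \<open>B\<close> misses \<open>q\<close>, so both sides are smaller
        and induction applies.\<close>
      have "A \<noteq> fst G" using KC CV Q(3) unfolding A_def by blast
      then obtain D1 where D1: "cyclic_orientation (induced_subgraph A G) D1" using sub AB(3) by blast
      have "B \<noteq> fst G" using Q(2) q unfolding B_def by blast
      then obtain D2 where D2: "cyclic_orientation (induced_subgraph B G) D2" using sub AB(4) by blast
      show ?thesis
      proof (rule glue_orientations[OF G AB(1) _ _ kl D1 D2])
        show False if "adj G a b" "a \<in> A - B" "b \<in> B - A" for a b by (rule sep[OF that])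
        show "adj G a b" if "a \<in> A \<inter> B" "b \<in> A \<inter> B" "a \<noteq> b" for a b
          using clique that unfolding AB(2) by blast
      qed
    qed
  qed
qed

theorem theorem2p8:
  fixes G :: "'a graph"
  assumes "simple_graph G"
  shows "cyclically_orientable G \<longleftrightarrow> \<not> induced_minor K4 G \<and> \<not> induced_minor K23 G"
proof -
  have "\<not> bad G" if h: "cyclically_orientable G"
  proof -
    obtain D where "cyclic_orientation G D"
      using h unfolding cyclically_orientable_iff[OF assms] by blast
    then interpret cyclic_orientation G D .
    show ?thesis unfolding bad_def using no_bad_pair by blast
  qed
  then show ?thesis
    using not_bad_cyclically_orientable[OF assms] bad_induced_minor[OF assms] induced_minor_bad[OF assms] by blast
qed

end
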